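(* Let $R$ be a commutative ring with $1$ and let $m\geq 1$. If $\operatorname{diam}(GF(R))=\infty$, then $\operatorname{diam}(GF(R[x_1,x_2,\ldots,x_m]))=4$. If $\operatorname{diam}(GF(R))=n<\infty$, then $\operatorname{diam}(GF(R))\leq \operatorname{diam}(GF(R[x_1,x_2,\ldots,x_m]))$ and the following hold. (1) If $n\leq 1$, then $\operatorname{diam}(GF(R[x_1,x_2,\ldots,x_m]))=2$. (2) If $R$ is Noetherian, then $\operatorname{diam}(GF(R[x_1,x_2,\ldots,x_m]))=2$. (3) If $n=4$, then $\operatorname{diam}(GF(R[x_1,x_2,\ldots,x_m]))=4$.
   Context: For a commutative ring $T$ with identity, $GF(T)$ is the simple undirected graph whose vertices are the proper ideals of $T$; two distinct proper ideals have an edge between them if and only if, for one of the two orderings $(I,J)$ of the pair, $I\subset J$ and $J/I$ is a finitely generated ideal of $T/I$. The diameter $\operatorname{diam}$ of a graph is the supremum of the distances between pairs of vertices, with $\operatorname{diam}=\infty$ if the graph is not connected. The case $n=0$ corresponds to $R$ being a field (the graph is a single vertex). *)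

theory Defs
  imports
    "HOL-Algebra.Algebra"
    "HOL-Algebra.Indexed_Polynomials"
    "Graph_Theory.Graph_Theory"
begin

section \<open>The graph of finitely generated quotients\<close>

definition proper_ideals :: "('a, 'b) ring_scheme \<Rightarrow> 'a set set" where
  "proper_ideals T = {I. ideal I T \<and> I \<noteq> carrier T}"

definition fg_ideal :: "'a set \<Rightarrow> ('a, 'b) ring_scheme \<Rightarrow> bool" where
  "fg_ideal I T \<longleftrightarrow> ideal I T \<and> (\<exists>A \<subseteq> carrier T. finite A \<and> I = Idl\<^bsub>T\<^esub> A)"

text \<open>The image \<open>J / I\<close> of \<open>J\<close> in \<open>T Quot I\<close>, whose elements are the cosets of \<open>I\<close>.\<close>

definition ideal_quot :: "('a, 'b) ring_scheme \<Rightarrow> 'a set \<Rightarrow> 'a set \<Rightarrow> 'a set set" where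
  "ideal_quot T J I = (\<lambda>j. I +>\<^bsub>T\<^esub> j) ` J"

definition fg_step :: "('a, 'b) ring_scheme \<Rightarrow> 'a set \<Rightarrow> 'a set \<Rightarrow> bool" where
  "fg_step T I J \<longleftrightarrow> I \<subset> J \<and> fg_ideal (ideal_quot T J I) (T Quot I)"

text \<open>A simple undirected graph is represented as a symmetric loop-free digraph whose arcs are
  pairs of vertices.\<close>

definition GF :: "('a, 'b) ring_scheme \<Rightarrow> 'a set pair_pre_digraph" where
  "GF T = \<lparr> pverts = proper_ideals T,
            parcs = {(I, J). I \<in> proper_ideals T \<and> J \<in> proper_ideals T \<and>
                             (fg_step T I J \<or> fg_step T J I)} \<rparr>"

lemma pair_wf_digraph_GF: "pair_wf_digraph (GF T)"
  by unfold_locales (auto simp: GF_def)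

lemma GF_simple:
  "loopfree_digraph (with_proj (GF T))" "nomulti_digraph (with_proj (GF T))"
  "sym_digraph (with_proj (GF T))"
proof -
  interpret pair_wf_digraph "GF T" by (rule pair_wf_digraph_GF)
  show "loopfree_digraph (with_proj (GF T))"
    by unfold_locales (auto simp: GF_def fg_step_def)
  show "nomulti_digraph (with_proj (GF T))"
    by unfold_locales (auto simp: arc_to_ends_def)
  show "sym_digraph (with_proj (GF T))"
    by unfold_locales (auto simp: symmetric_conv GF_def)
qed

text \<open>With unit arc weights, \<open>\<mu>\<close> is the length of a shortest walk, and \<open>\<infinity>\<close> if there is none.\<close>

definition graph_dist :: "('v, 'e) pre_digraph \<Rightarrow> 'v \<Rightarrow> 'v \<Rightarrow> ereal" where
  "graph_dist G u v = wf_digraph.\<mu> G (\<lambda>_. 1) u v"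

definition diam :: "('v, 'e) pre_digraph \<Rightarrow> ereal" where
  "diam G = (SUP u \<in> verts G. SUP v \<in> verts G. graph_dist G u v)"


section \<open>Polynomial rings in several variables\<close>

text \<open>\<open>HOL-Algebra.Indexed_Polynomials\<close> provides the carrier \<open>(carrier R)[\<X>\<^bsub>I\<^esub>]\<close> (coefficient functions
  on monomials, a monomial being a multiset of variables) and its addition, but not the convolution
  product or the ring.\<close>

context ring
begin

definition indexed_mult :: "('c multiset \<Rightarrow> 'a) \<Rightarrow> ('c multiset \<Rightarrow> 'a) \<Rightarrow> ('c multiset \<Rightarrow> 'a)" where
  "indexed_mult P Q = (\<lambda>m. \<Oplus>k \<in> {k. k \<subseteq># m}. P k \<otimes> Q (m - k))"

definition indexed_poly_ring :: "'c set \<Rightarrow> ('c multiset \<Rightarrow> 'a) ring" where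
  "indexed_poly_ring I =
     \<lparr> carrier = (carrier R)[\<X>\<^bsub>I\<^esub>], monoid.mult = indexed_mult, one = indexed_const \<one>,
       ring.zero = indexed_const \<zero>, ring.add = indexed_padd \<rparr>"

end

lemma (in ring) indexed_pset_iff:
  "P \<in> ((carrier R)[\<X>\<^bsub>I\<^esub>]) \<longleftrightarrow>
     carrier_coeff P \<and> finite {m. P m \<noteq> \<zero>} \<and> (\<forall>m. P m \<noteq> \<zero> \<longrightarrow> set_mset m \<subseteq> I)"
  (is "?L \<longleftrightarrow> ?R")
proof
  assume ?L
  then show ?R
  proof induction
    case (indexed_const k)
    have "{m. indexed_const k m \<noteq> \<zero>} \<subseteq> {{#} :: 'c multiset}"
      by (auto simp: indexed_const_def)
    then show ?case
      using indexed_const finite_subset by (force simp: indexed_const_def carrier_coeff_def)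
  next
    case (indexed_padd P Q)
    have *: "{m. (P \<Oplus> Q) m \<noteq> \<zero>} \<subseteq> {m. P m \<noteq> \<zero>} \<union> {m. Q m \<noteq> \<zero>}"
      by (auto simp: indexed_padd_def)
    have "finite {m. (P \<Oplus> Q) m \<noteq> \<zero>}"
      by (rule finite_subset[OF *]) (use indexed_padd in auto)
    moreover have "\<forall>m. (P \<Oplus> Q) m \<noteq> \<zero> \<longrightarrow> set_mset m \<subseteq> I"
      using * indexed_padd by blast
    ultimately show ?case
      using indexed_padd by (simp add: indexed_padd_in_carrier)
  next
    case (indexed_pmult P i)
    have *: "{m. (P \<Otimes> i) m \<noteq> \<zero>} \<subseteq> add_mset i ` {m. P m \<noteq> \<zero>}"
    proof
      fix m assume "m \<in> {m. (P \<Otimes> i) m \<noteq> \<zero>}"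
      then have "i \<in># m" "P (m - {#i#}) \<noteq> \<zero>"
        by (auto simp: indexed_pmult_def split: if_splits)
      then show "m \<in> add_mset i ` {m. P m \<noteq> \<zero>}"
        by (intro image_eqI[of _ _ "m - {#i#}"]) auto
    qed
    have "finite {m. (P \<Otimes> i) m \<noteq> \<zero>}"
      by (rule finite_subset[OF *]) (use indexed_pmult in auto)
    moreover have "\<forall>m. (P \<Otimes> i) m \<noteq> \<zero> \<longrightarrow> set_mset m \<subseteq> I"
    proof (intro allI impI)
      fix m assume "(P \<Otimes> i) m \<noteq> \<zero>"
      then obtain n where "m = add_mset i n" "P n \<noteq> \<zero>" using * by blast
      then show "set_mset m \<subseteq> I" using indexed_pmult by auto
    qed
    ultimately show ?case
      using indexed_pmult by (simp add: indexed_pmult_in_carrier)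
  qed
next
  assume ?R
  have mono: "(\<lambda>m. if m = n then k else \<zero>) \<in> ((carrier R)[\<X>\<^bsub>I\<^esub>])"
    if "k \<in> carrier R" "set_mset n \<subseteq> I" for k and n :: "'c multiset"
    using that(2)
  proof (induction n)
    case empty
    show ?case using indexed_pset.indexed_const[OF that(1)] by (simp add: indexed_const_def)
  next
    case (add i n)
    have "(\<lambda>m. if m = add_mset i n then k else \<zero>) = (\<lambda>m. if m = n then k else \<zero>) \<Otimes> i"
      by (auto simp: indexed_pmult_def fun_eq_iff)
    then show ?case using add by (auto intro: indexed_pset.indexed_pmult)
  qed
  have "P \<in> ((carrier R)[\<X>\<^bsub>I\<^esub>])"
    if "finite A" "{m. P m \<noteq> \<zero>} = A" "carrier_coeff P" "\<forall>m. P m \<noteq> \<zero> \<longrightarrow> set_mset m \<subseteq> I" for A P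
    using that
  proof (induction A arbitrary: P rule: finite_induct)
    case empty
    then have "P = indexed_const \<zero>" by (auto simp: indexed_const_def)
    then show ?case by (auto intro: indexed_pset.indexed_const)
  next
    case (insert n A)
    define Q where "Q = P(n := \<zero>)"
    have n: "P n \<in> carrier R" "set_mset n \<subseteq> I"
      using insert.prems by (auto simp: carrier_coeff_def)
    have "Q \<in> ((carrier R)[\<X>\<^bsub>I\<^esub>])"
    proof (rule insert.IH)
      show "{m. Q m \<noteq> \<zero>} = A"
        using insert.prems(1) insert.hyps by (auto simp: Q_def)
      show "carrier_coeff Q" "\<forall>m. Q m \<noteq> \<zero> \<longrightarrow> set_mset m \<subseteq> I"
        using insert.prems by (auto simp: Q_def carrier_coeff_def)
    qed
    moreover have "P = Q \<Oplus> (\<lambda>m. if m = n then P n else \<zero>)"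
      using insert.prems(2) by (auto simp: Q_def indexed_padd_def fun_eq_iff carrier_coeff_def)
    ultimately show ?case
      using mono[OF n] indexed_pset.indexed_padd by metis
  qed
  then show ?L using \<open>?R\<close> by blast
qed

lemma finite_submultisets: "finite {k. k \<subseteq># (m :: 'c multiset)}"
proof (induction m)
  case (add x m)
  have "{k. k \<subseteq># add_mset x m} \<subseteq> {k. k \<subseteq># m} \<union> add_mset x ` {k. k \<subseteq># m}"
  proof
    fix k assume "k \<in> {k. k \<subseteq># add_mset x m}"
    then have k: "k \<subseteq># add_mset x m" by simp
    show "k \<in> {k. k \<subseteq># m} \<union> add_mset x ` {k. k \<subseteq># m}"
    proof (cases "x \<in># k")
      case True
      then obtain k' where "k = add_mset x k'" by (metis insert_DiffM)
      then show ?thesis using k by auto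
    next
      case False
      have "count k y \<le> count m y" for y
        using mset_subset_eq_count[OF k, of y] False
        by (cases "y = x") (auto simp: not_in_iff)
      then show ?thesis by (auto intro: mset_subset_eqI)
    qed
  qed
  then show ?case using add by (meson finite_UnI finite_imageI finite_subset)
qed simp

context cring
begin

lemma indexed_mult_coeff:
  "carrier_coeff P \<Longrightarrow> carrier_coeff Q \<Longrightarrow> carrier_coeff (indexed_mult P Q)"
  unfolding carrier_coeff_def indexed_mult_def by (auto intro!: finsum_closed)

lemma indexed_mult_comm:
  fixes P Q :: "'c multiset \<Rightarrow> 'a"
  assumes "carrier_coeff P" "carrier_coeff Q"
  shows "indexed_mult P Q = indexed_mult Q P"
proof
  fix m :: "'c multiset"
  note [simp] = assms[THEN carrier_coeffE]
  have "bij_betw (\<lambda>k. m - k) {k. k \<subseteq># m} {k. k \<subseteq># m}"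
    by (rule bij_betw_byWitness[where f' = "\<lambda>k. m - k"])
       (auto simp: subset_mset.diff_diff_right subset_mset.add_diff_assoc)
  then have b: "inj_on (\<lambda>k. m - k) {k. k \<subseteq># m}" "(\<lambda>k. m - k) ` {k. k \<subseteq># m} = {k. k \<subseteq># m}"
    by (auto simp: bij_betw_def)
  have "(\<Oplus>k \<in> {k. k \<subseteq># m}. P k \<otimes> Q (m - k)) =
        (\<Oplus>k \<in> (\<lambda>k. m - k) ` {k. k \<subseteq># m}. P k \<otimes> Q (m - k))"
    by (simp only: b)
  also have "\<dots> = (\<Oplus>k \<in> {k. k \<subseteq># m}. P (m - k) \<otimes> Q (m - (m - k)))"
    by (rule finsum_reindex[OF _ b(1)]) auto
  also have "\<dots> = (\<Oplus>k \<in> {k. k \<subseteq># m}. Q k \<otimes> P (m - k))"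
    by (rule finsum_cong') (auto simp: subset_mset.diff_diff_right m_comm)
  finally show "indexed_mult P Q m = indexed_mult Q P m"
    by (simp add: indexed_mult_def)
qed

lemma indexed_mult_const:
  fixes Q :: "'c multiset \<Rightarrow> 'a"
  assumes "c \<in> carrier R" "carrier_coeff Q"
  shows "indexed_mult (indexed_const c) Q = (\<lambda>m. c \<otimes> Q m)"
proof
  fix m :: "'c multiset"
  note [simp] = assms(1) assms(2)[THEN carrier_coeffE]
  have "(\<Oplus>k \<in> {k. k \<subseteq># m}. indexed_const c k \<otimes> Q (m - k)) =
        (\<Oplus>k \<in> {k. k \<subseteq># m}. if {#} = k then c \<otimes> Q (m - k) else \<zero>)"
    by (rule finsum_cong') (auto simp: indexed_const_def)
  also have "\<dots> = c \<otimes> Q (m - {#})"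
    by (rule finsum_singleton) (auto simp: finite_submultisets)
  finally show "indexed_mult (indexed_const c) Q m = c \<otimes> Q m"
    by (simp add: indexed_mult_def)
qed

lemma indexed_mult_add:
  assumes "carrier_coeff P" "carrier_coeff P'" "carrier_coeff Q"
  shows "indexed_mult (P \<Oplus> P') Q = indexed_mult P Q \<Oplus> indexed_mult P' Q"
  unfolding indexed_mult_def indexed_padd_def
  using assms[THEN carrier_coeffE]
  by (auto simp: fun_eq_iff l_distr finsum_addf Pi_def)

lemma indexed_mult_pmult:
  fixes P Q :: "'c multiset \<Rightarrow> 'a"
  assumes "carrier_coeff P" "carrier_coeff Q"
  shows "indexed_mult (P \<Otimes> i) Q = indexed_mult P Q \<Otimes> i"
proof
  fix m :: "'c multiset"
  note [simp] = assms[THEN carrier_coeffE]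
  have cl: "(P \<Otimes> i) k \<in> carrier R" for k by (simp add: indexed_pmult_def)
  show "indexed_mult (P \<Otimes> i) Q m = (indexed_mult P Q \<Otimes> i) m"
  proof (cases "i \<in># m")
    case False
    have "(\<Oplus>k \<in> {k. k \<subseteq># m}. (P \<Otimes> i) k \<otimes> Q (m - k)) = (\<Oplus>k \<in> {k. k \<subseteq># m}. \<zero>)"
      by (rule finsum_cong') (use False in \<open>auto simp: indexed_pmult_def dest: mset_subset_eqD\<close>)
    then show ?thesis using False by (simp add: indexed_mult_def indexed_pmult_def[of "\<lambda>m. _ m"])
  next
    case True
    then obtain n where m: "m = add_mset i n" by (metis insert_DiffM)
    have sub: "add_mset i ` {k. k \<subseteq># n} \<subseteq> {k. k \<subseteq># m}" by (auto simp: m)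
    have "(\<Oplus>k \<in> {k. k \<subseteq># m}. (P \<Otimes> i) k \<otimes> Q (m - k)) =
          (\<Oplus>k \<in> add_mset i ` {k. k \<subseteq># n}. (P \<Otimes> i) k \<otimes> Q (m - k))"
    proof (rule add.finprod_mono_neutral_cong_right[OF finite_submultisets sub])
      fix k assume k: "k \<in> {k. k \<subseteq># m} - add_mset i ` {k. k \<subseteq># n}"
      have "i \<notin># k"
      proof
        assume "i \<in># k"
        then obtain k' where "k = add_mset i k'" by (metis insert_DiffM)
        then show False using k m by auto
      qed
      then show "(P \<Otimes> i) k \<otimes> Q (m - k) = \<zero>" by (simp add: indexed_pmult_def)
    qed (use cl in auto)
    also have "\<dots> = (\<Oplus>k \<in> {k. k \<subseteq># n}. (P \<Otimes> i) (add_mset i k) \<otimes> Q (m - add_mset i k))"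
      by (rule finsum_reindex) (use cl in \<open>auto simp: inj_on_def\<close>)
    also have "\<dots> = (\<Oplus>k \<in> {k. k \<subseteq># n}. P k \<otimes> Q (n - k))"
      by (rule finsum_cong') (auto simp: indexed_pmult_def m)
    finally show ?thesis using True m by (simp add: indexed_mult_def indexed_pmult_def[of "\<lambda>m. _ m"])
  qed
qed

lemma cring_indexed_poly_ring: "cring (indexed_poly_ring I)"
proof -
  let ?S = "(carrier R)[\<X>\<^bsub>I\<^esub>]"
  have cc: "carrier_coeff P" if "P \<in> ?S" for P
    using that by (rule indexed_pset_in_carrier[OF subset_refl])
  have scal: "(\<lambda>m. c \<otimes> Q m) \<in> ?S" if "c \<in> carrier R" "Q \<in> ?S" for c Q
  proof -
    note Q = \<open>Q \<in> ?S\<close>[unfolded indexed_pset_iff]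
    have "{m. c \<otimes> Q m \<noteq> \<zero>} \<subseteq> {m. Q m \<noteq> \<zero>}" using that(1) by auto
    then show ?thesis
      using Q that(1) finite_subset unfolding indexed_pset_iff carrier_coeff_def by auto
  qed
  have closed: "indexed_mult P Q \<in> ?S" if "P \<in> ?S" "Q \<in> ?S" for P Q
    using that(1)
  proof induction
    case (indexed_const k)
    then show ?case using scal that(2) by (simp add: indexed_mult_const cc)
  next
    case (indexed_padd P P')
    then show ?case
      using indexed_mult_add[of P P' Q] that(2) by (auto simp: cc intro: indexed_pset.indexed_padd)
  next
    case (indexed_pmult P i)
    then show ?case
      using indexed_mult_pmult[of P Q i] that(2) by (auto simp: cc intro: indexed_pset.indexed_pmult)
  qed
  have assoc: "indexed_mult (indexed_mult P Q) T = indexed_mult P (indexed_mult Q T)"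
    if "P \<in> ?S" "carrier_coeff Q" "carrier_coeff T" for P Q T
    using that(1)
  proof induction
    case (indexed_const k)
    note [simp] = that(2,3)[THEN carrier_coeffE] indexed_const
    have "carrier_coeff (\<lambda>m. k \<otimes> Q m)" by (simp add: carrier_coeff_def)
    then have "indexed_mult (\<lambda>m. k \<otimes> Q m) T = (\<lambda>m. k \<otimes> indexed_mult Q T m)"
      using that unfolding indexed_mult_def
      by (auto simp: fun_eq_iff finsum_rdistr finite_submultisets m_assoc Pi_def)
    then show ?case using that by (simp add: indexed_mult_const indexed_mult_coeff)
  next
    case (indexed_padd P P')
    then show ?case using that by (simp add: indexed_mult_add indexed_mult_coeff cc)
  next
    case (indexed_pmult P i)
    then show ?case using that by (simp add: indexed_mult_pmult indexed_mult_coeff cc)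
  qed
  have "abelian_group (indexed_poly_ring I)"
  proof (rule abelian_groupI)
    fix P assume "P \<in> carrier (indexed_poly_ring I)"
    then have P: "P \<in> ?S" by (simp add: indexed_poly_ring_def)
    have "(\<lambda>m. (\<ominus> \<one>) \<otimes> P m) \<in> ?S" by (rule scal[OF _ P]) simp
    moreover have "(\<lambda>m. (\<ominus> \<one>) \<otimes> P m) \<Oplus> P = indexed_const \<zero>"
      using cc[OF P, THEN carrier_coeffE]
      by (simp add: indexed_padd_def indexed_zero_def l_minus l_neg)
    ultimately show "\<exists>Q \<in> carrier (indexed_poly_ring I).
        Q \<oplus>\<^bsub>indexed_poly_ring I\<^esub> P = \<zero>\<^bsub>indexed_poly_ring I\<^esub>"
      by (auto simp: indexed_poly_ring_def)
  qed (auto simp: indexed_poly_ring_def cc indexed_padd_zero intro: indexed_pset.intros,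
       auto simp: indexed_padd_def fun_eq_iff carrier_coeffE cc a_ac)
  moreover have "comm_monoid (indexed_poly_ring I)"
    by (rule comm_monoidI)
       (auto simp: indexed_poly_ring_def cc closed assoc indexed_mult_const carrier_coeffE
             intro: indexed_pset.indexed_const indexed_mult_comm)
  ultimately show ?thesis
    by (rule cringI) (auto simp: indexed_poly_ring_def indexed_mult_add cc)
qed

end

abbreviation mpoly_ring :: "('a, 'b) ring_scheme \<Rightarrow> nat \<Rightarrow> (nat multiset \<Rightarrow> 'a) ring" where
  "mpoly_ring R m \<equiv> ring.indexed_poly_ring R {1..m}"

end

theory Submission
  imports Defs
begin

text \<open>
  Call two proper ideals adjacent if they are equal or joined by an edge, and write \<open>S\<close> for the
  polynomial ring. All claims follow from three facts about \<open>S\<close> and two about \<open>R\<close>.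

  \<^item> \<open>S\<close> is not local: for a variable \<open>X\<close>, neither \<open>X\<close> nor \<open>1 - X\<close> is a unit. In such a ring any two
    proper ideals are at distance at most 4 (\<open>diam_le_4_if_comaximal\<close>). The reason is that comaximal
    ideals \<open>I\<close> and \<open>J\<close> are at distance at most 2 through \<open>I \<inter> J\<close>, because \<open>I / (I \<inter> J)\<close> is isomorphic
    to the cyclic module \<open>S / J\<close>. So it suffices either to enlarge both ideals by one element until
    they are comaximal, or to find one proper ideal that is comaximal to both. Moreover, the ideals
    generated by \<open>X\<close> and by \<open>1 - X\<close> are incomparable, so the diameter is at least 2.

  \<^item> Taking the constant coefficient is a surjective homomorphism \<open>S \<Rightarrow> R\<close>. Ideals of \<open>R\<close> can be pulled
    back to \<open>S\<close>, and walks in \<open>GF S\<close> can be pushed down to \<open>R\<close> as long as no vertex of the walk is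
    mapped onto all of \<open>R\<close>. That accident cannot happen to a neighbour of a pulled-back ideal, and in
    a walk of length at most 3 every vertex is an endpoint or the neighbour of one. Hence distances
    below 4 do not shrink, which gives \<open>min 4 (diam (GF R)) \<le> diam (GF S)\<close> (\<open>min_diam_GF_le\<close>).
    The argument ends there: if \<open>GF R\<close> is not connected, some of the walks of length 4 from the first
    item necessarily pass through an ideal that is mapped onto \<open>R\<close>.

  \<^item> If \<open>R\<close> is Noetherian, so is \<open>S\<close>, by Hilbert's basis theorem (\<open>noetherian_poly_ring\<close>). In a
    Noetherian ring every proper ideal is adjacent to 0, so the diameter is at most 2.

  \<^item> If \<open>diam (GF R)\<close> is finite, it is at most 4 (\<open>diam_le_4_if_finite\<close>). For non-local \<open>R\<close> this is the
    first item again. If \<open>R\<close> is local with maximal ideal \<open>M\<close>, the ideals \<open>A\<close> for which \<open>M / A\<close> is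
    finitely generated form a union of connected components; as \<open>GF R\<close> is connected, 0 is among them,
    so \<open>M\<close> is finitely generated and every proper ideal is adjacent to \<open>M\<close>.

  \<^item> If \<open>diam (GF R) \<le> 1\<close>, every proper ideal is adjacent to 0, that is, \<open>R\<close> is Noetherian.
\<close>

(* below, this symbol is reserved for the addition of a ring *)
no_notation vwalk_join (infixr "\<oplus>" 65)

section \<open>Distances and walks\<close>

lemma relpow_2I: "(x, y) \<in> r \<Longrightarrow> (y, z) \<in> r \<Longrightarrow> (x, z) \<in> r ^^ 2"
  by (auto simp: numeral_2_eq_2)

lemma relpow_2D: "(x, z) \<in> r ^^ 2 \<Longrightarrow> \<exists>y. (x, y) \<in> r \<and> (y, z) \<in> r"
  by (auto simp: numeral_2_eq_2)

lemma relpow_3I: "(x, y) \<in> r \<Longrightarrow> (y, z) \<in> r \<Longrightarrow> (z, w) \<in> r \<Longrightarrow> (x, w) \<in> r ^^ 3"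
  by (auto simp: numeral_3_eq_3)

lemma relpow_3D: "(x, w) \<in> r ^^ 3 \<Longrightarrow> \<exists>y z. (x, y) \<in> r \<and> (y, z) \<in> r \<and> (z, w) \<in> r"
  by (auto simp: numeral_3_eq_3)

text \<open>With the reflexive closure of the arc relation, the \<open>k\<close>-th power contains the pairs that are
  joined by a walk of length at most \<open>k\<close>, so that walks need not be tracked explicitly and
  degenerate steps do no harm.\<close>

lemma (in pair_wf_digraph) awalk_imp_relpow_reflcl:
  "awalk u p v \<Longrightarrow> (u, v) \<in> ((parcs G)\<^sup>=) ^^ length p"
proof (induction p arbitrary: u)
  case Nil
  then show ?case by (simp add: awalk_Nil_iff)
next
  case (Cons e p)
  then have "e \<in> parcs G" "fst e = u" "awalk (snd e) p v"
    by (auto simp: awalk_Cons_iff)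
  then have "(u, snd e) \<in> (parcs G)\<^sup>=" "(snd e, v) \<in> ((parcs G)\<^sup>=) ^^ length p"
    using Cons.IH by auto
  then show ?case by (simp only: list.size add_Suc_right add_0_right relpow_Suc_I2)
qed

lemma (in pair_wf_digraph) relpow_reflcl_imp_awalk:
  "(u, v) \<in> ((parcs G)\<^sup>=) ^^ k \<Longrightarrow> u \<in> pverts G \<Longrightarrow> \<exists>p. awalk u p v \<and> length p \<le> k"
proof (induction k arbitrary: u)
  case 0
  then show ?case by (auto simp: awalk_Nil_iff intro: exI[of _ "[]"])
next
  case (Suc k)
  then obtain w where w: "(u, w) \<in> (parcs G)\<^sup>=" "(w, v) \<in> ((parcs G)\<^sup>=) ^^ k"
    by (meson relpow_Suc_D2)
  with Suc.prems have "w \<in> pverts G" using in_arcsD2 by auto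
  with Suc.IH w obtain p where p: "awalk w p v" "length p \<le> k" by blast
  show ?case
  proof (cases "u = w")
    case True
    with p show ?thesis by (auto intro: exI[of _ p])
  next
    case False
    with w p Suc.prems show ?thesis
      by (auto simp: awalk_Cons_iff intro!: exI[of _ "(u, w) # p"])
  qed
qed

context
  fixes G :: "'a pair_pre_digraph" and u :: 'a
  assumes G: "pair_wf_digraph G" and u: "u \<in> pverts G"
begin

interpretation pair_wf_digraph G by (rule G)

lemma graph_dist_conv_walks:
  "graph_dist (with_proj G) u v = (INF p \<in> {p. awalk u p v}. ereal (real (length p)))"
proof -
  have "awalk_cost (\<lambda>_. 1) p = real (length p)" for p :: "('a \<times> 'a) list"
    by (induction p) auto
  then show ?thesis by (simp add: graph_dist_def \<mu>_def)
qed

lemma graph_dist_le: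
  assumes "(u, v) \<in> ((parcs G)\<^sup>=) ^^ k"
  shows "graph_dist (with_proj G) u v \<le> ereal (real k)"
proof -
  obtain p where p: "awalk u p v" "length p \<le> k"
    using relpow_reflcl_imp_awalk[OF assms u] by blast
  then show ?thesis
    unfolding graph_dist_conv_walks by (intro INF_lower2[of p]) auto
qed

lemma le_graph_dist:
  assumes "\<And>k. (u, v) \<in> ((parcs G)\<^sup>=) ^^ k \<Longrightarrow> c \<le> ereal (real k)"
  shows "c \<le> graph_dist (with_proj G) u v"
  unfolding graph_dist_conv_walks using assms awalk_imp_relpow_reflcl by (intro INF_greatest) auto

end

section \<open>Finitely generated extensions of ideals\<close>

text \<open>The relation \<open>J = I + (F)\<close> with finite \<open>F\<close>, which avoids the quotient ring and, unlike
  \<^const>\<open>fg_step\<close>, is reflexive.\<close>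

definition fg_ext :: "('a, 'b) ring_scheme \<Rightarrow> 'a set \<Rightarrow> 'a set \<Rightarrow> bool" where
  "fg_ext T I J \<longleftrightarrow> (\<exists>F \<subseteq> carrier T. finite F \<and> J = Idl\<^bsub>T\<^esub> (I \<union> F))"

lemma ideal_subset_carrier: "ideal I T \<Longrightarrow> I \<subseteq> carrier T"
  by (simp add: additive_subgroup.a_subset ideal.axioms(1))

lemma proper_idealsD:
  assumes "I \<in> proper_ideals T"
  shows "ideal I T" "I \<noteq> carrier T" "I \<subseteq> carrier T" "\<one>\<^bsub>T\<^esub> \<notin> I"
proof -
  show *: "ideal I T" and ne: "I \<noteq> carrier T" using assms by (auto simp: proper_ideals_def)
  show "I \<subseteq> carrier T" by (rule ideal_subset_carrier[OF *])
  show "\<one>\<^bsub>T\<^esub> \<notin> I" using ideal.one_imp_carrier[OF *] ne by blast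
qed

context ring
begin

lemma proper_idealsI: "ideal I R \<Longrightarrow> \<one> \<notin> I \<Longrightarrow> I \<in> proper_ideals R"
  by (auto simp: proper_ideals_def)

lemma genideal_of_ideal: "ideal I R \<Longrightarrow> Idl I = I"
  by (intro equalityI genideal_minimal genideal_self ideal_subset_carrier order_refl)

lemma fg_ext_imp_subset: "ideal I R \<Longrightarrow> fg_ext R I J \<Longrightarrow> I \<subseteq> J"
proof -
  assume "ideal I R" "fg_ext R I J"
  then obtain F where F: "F \<subseteq> carrier R" "J = Idl (I \<union> F)" by (auto simp: fg_ext_def)
  with genideal_self[of "I \<union> F"] ideal_subset_carrier[OF \<open>ideal I R\<close>] show "I \<subseteq> J" by simp
qed

lemma fg_ext_refl: "ideal I R \<Longrightarrow> fg_ext R I I"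
  unfolding fg_ext_def by (intro exI[of _ "{}"]) (simp add: genideal_of_ideal)

text \<open>Together with \<open>I\<close>, the set \<open>F\<close> generates \<open>J\<close>; in this form no generated ideal has to be
  mentioned.\<close>

lemma fg_extI:
  assumes "ideal J R" "I \<subseteq> J" "F \<subseteq> J" "finite F"
    and "\<And>K. ideal K R \<Longrightarrow> I \<subseteq> K \<Longrightarrow> F \<subseteq> K \<Longrightarrow> J \<subseteq> K"
  shows "fg_ext R I J"
proof -
  have c: "I \<union> F \<subseteq> carrier R" using assms(2,3) ideal_subset_carrier[OF assms(1)] by blast
  have "Idl (I \<union> F) = J"
  proof (rule equalityI)
    show "J \<subseteq> Idl (I \<union> F)"
      using genideal_ideal[OF c] genideal_self[OF c] by (intro assms(5)) auto
  qed (use assms(1-3) in \<open>simp add: genideal_minimal\<close>)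
  then show ?thesis unfolding fg_ext_def using c assms(4) by auto
qed

end

lemma (in ring_hom_ring) ideal_image:
  assumes surj: "h ` carrier R = carrier S" and I: "ideal I R"
  shows "ideal (h ` I) S"
proof (rule idealI)
  have "subgroup I (add_monoid R)"
    using I by (simp add: additive_subgroup.a_subgroup ideal.axioms(1))
  then show "subgroup (h ` I) (add_monoid S)" by (rule img_is_add_subgroup)
next
  fix b x assume "b \<in> h ` I" "x \<in> carrier S"
  then obtain a y where ay: "a \<in> I" "b = h a" "y \<in> carrier R" "x = h y"
    using surj by blast
  then have "a \<in> carrier R" using ideal_subset_carrier[OF I] by blast
  with ay have "x \<otimes>\<^bsub>S\<^esub> b = h (y \<otimes>\<^bsub>R\<^esub> a)" "b \<otimes>\<^bsub>S\<^esub> x = h (a \<otimes>\<^bsub>R\<^esub> y)" by auto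
  with ay show "x \<otimes>\<^bsub>S\<^esub> b \<in> h ` I" "b \<otimes>\<^bsub>S\<^esub> x \<in> h ` I"
    using ideal.I_l_closed[OF I] ideal.I_r_closed[OF I] by auto
qed (rule S.ring_axioms)

lemma (in ring_hom_ring) image_genideal:
  assumes surj: "h ` carrier R = carrier S" and A: "A \<subseteq> carrier R"
  shows "h ` (Idl\<^bsub>R\<^esub> A) = Idl\<^bsub>S\<^esub> (h ` A)"
proof
  have hA: "h ` A \<subseteq> carrier S" using A by auto
  show "Idl\<^bsub>S\<^esub> (h ` A) \<subseteq> h ` (Idl\<^bsub>R\<^esub> A)"
    using ideal_image[OF surj R.genideal_ideal[OF A]] R.genideal_self[OF A]
    by (intro S.genideal_minimal) auto
  have "Idl\<^bsub>R\<^esub> A \<subseteq> {r \<in> carrier R. h r \<in> Idl\<^bsub>S\<^esub> (h ` A)}"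
    using ideal_vimage[OF S.genideal_ideal[OF hA]] S.genideal_self[OF hA] A
    by (intro R.genideal_minimal) auto
  then show "h ` (Idl\<^bsub>R\<^esub> A) \<subseteq> Idl\<^bsub>S\<^esub> (h ` A)" by auto
qed

lemma (in ring_hom_ring) fg_ext_image:
  assumes surj: "h ` carrier R = carrier S" and "I \<subseteq> carrier R" "fg_ext R I J"
  shows "fg_ext S (h ` I) (h ` J)"
proof -
  obtain F where "F \<subseteq> carrier R" "finite F" "J = Idl\<^bsub>R\<^esub> (I \<union> F)"
    using assms(3) by (auto simp: fg_ext_def)
  with assms(2) show ?thesis
    unfolding fg_ext_def
    by (intro exI[of _ "h ` F"]) (auto simp: image_genideal[OF surj] image_Un)
qed

text \<open>The correspondence theorem: above the kernel, ideals are determined by their images.\<close>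

lemma (in ring_hom_ring) image_eq_imp_subset:
  assumes K: "ideal K R" and ker: "a_kernel R S h \<subseteq> K" and J: "J \<subseteq> carrier R"
    and im: "h ` J \<subseteq> h ` K"
  shows "J \<subseteq> K"
proof
  fix x assume x: "x \<in> J"
  then obtain y where y: "y \<in> K" "h x = h y" using im by blast
  have c: "x \<in> carrier R" "y \<in> carrier R" using x y J ideal_subset_carrier[OF K] by auto
  have "h (x \<ominus>\<^bsub>R\<^esub> y) = h x \<oplus>\<^bsub>S\<^esub> \<ominus>\<^bsub>S\<^esub> h y"
    using c unfolding R.minus_eq by simp
  also have "\<dots> = \<zero>\<^bsub>S\<^esub>"
    unfolding y(2) by (rule S.r_neg) (use c in simp)
  finally have "x \<ominus>\<^bsub>R\<^esub> y \<in> K"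
    using c ker unfolding a_kernel_def' by auto
  then have "(x \<ominus>\<^bsub>R\<^esub> y) \<oplus>\<^bsub>R\<^esub> y \<in> K"
    using y(1) by (rule additive_subgroup.a_closed[OF ideal.axioms(1)[OF K]])
  moreover have "(x \<ominus>\<^bsub>R\<^esub> y) \<oplus>\<^bsub>R\<^esub> y = x"
    using c by (simp only: R.minus_eq R.a_assoc R.l_neg R.r_zero R.a_inv_closed)
  ultimately show "x \<in> K" by simp
qed

lemma (in ideal) a_kernel_rcos: "a_kernel R (R Quot I) ((+>) I) = I"
proof -
  have z: "\<zero>\<^bsub>R Quot I\<^esub> = I" by (simp add: FactRing_def)
  show ?thesis
    unfolding a_kernel_def' z
    using a_rcos_zero[OF is_ideal] rcos_const_imp_mem a_subset by blast
qed

lemma (in ideal) surj_rcos: "(+>) I ` carrier R = carrier (R Quot I)"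
  unfolding FactRing_def A_RCOSETS_def' by auto

lemma (in ideal) rcos_image_genideal_Un:
  assumes F: "F \<subseteq> carrier R"
  shows "(+>) I ` (Idl (I \<union> F)) = Idl\<^bsub>R Quot I\<^esub> ((+>) I ` F)"
proof -
  have z0: "\<zero>\<^bsub>R Quot I\<^esub> = I" by (simp add: FactRing_def)
  interpret q: ring_hom_ring R "R Quot I" "(+>) I" by (rule rcos_ring_hom_ring)
  let ?z = "\<zero>\<^bsub>R Quot I\<^esub>" and ?F = "(+>) I ` F"
  have "(+>) I ` I = (\<lambda>_. ?z) ` I"
    unfolding z0 by (rule image_cong[OF refl a_rcos_zero[OF is_ideal]])
  also have "\<dots> = {?z}" using additive_subgroup.zero_closed[OF is_additive_subgroup] by blast
  finally have z: "(+>) I ` I = {?z}" .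
  have c: "?F \<subseteq> carrier (R Quot I)" "{?z} \<union> ?F \<subseteq> carrier (R Quot I)"
    using F surj_rcos q.S.zero_closed by blast+
  have "(+>) I ` (Idl (I \<union> F)) = Idl\<^bsub>R Quot I\<^esub> ((+>) I ` (I \<union> F))"
    by (rule q.image_genideal[OF surj_rcos]) (use F a_subset in blast)
  also have "\<dots> = Idl\<^bsub>R Quot I\<^esub> ({?z} \<union> ?F)" by (simp only: image_Un z)
  also have "\<dots> = Idl\<^bsub>R Quot I\<^esub> ?F"
  proof (rule equalityI)
    have "?z \<in> Idl\<^bsub>R Quot I\<^esub> ?F"
      by (rule additive_subgroup.zero_closed[OF ideal.axioms(1)[OF q.S.genideal_ideal[OF c(1)]]])
    then show "Idl\<^bsub>R Quot I\<^esub> ({?z} \<union> ?F) \<subseteq> Idl\<^bsub>R Quot I\<^esub> ?F"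
      using q.S.genideal_self[OF c(1)]
      by (intro q.S.genideal_minimal q.S.genideal_ideal[OF c(1)]) blast
    show "Idl\<^bsub>R Quot I\<^esub> ?F \<subseteq> Idl\<^bsub>R Quot I\<^esub> ({?z} \<union> ?F)"
      by (rule q.S.subset_Idl_subset[OF c(2)]) blast
  qed
  finally show ?thesis .
qed

text \<open>Finite generating sets of \<open>J / I\<close> lift to \<open>J\<close>, and both \<open>J\<close> and the ideal generated by \<open>I\<close> and the
  lifted set contain the kernel \<open>I\<close> of the projection, so they agree if their images do.\<close>

lemma (in ring) fg_step_iff:
  assumes I: "ideal I R" and J: "ideal J R"
  shows "fg_step R I J \<longleftrightarrow> I \<noteq> J \<and> fg_ext R I J"
proof -
  interpret I: ideal I R by (rule I)
  interpret q: ring_hom_ring R "R Quot I" "(+>) I" by (rule I.rcos_ring_hom_ring)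
  have Jc: "J \<subseteq> carrier R" by (rule ideal_subset_carrier[OF J])
  show ?thesis
  proof
    assume L: "fg_step R I J"
    then have IJ: "I \<noteq> J" "I \<subseteq> J" by (auto simp: fg_step_def)
    obtain A where A: "A \<subseteq> (+>) I ` carrier R" "finite A" "(+>) I ` J = Idl\<^bsub>R Quot I\<^esub> A"
      using L unfolding fg_step_def fg_ideal_def ideal_quot_def I.surj_rcos by blast
    then obtain F where F: "F \<subseteq> carrier R" "finite F" "A = (+>) I ` F"
      by (meson finite_subset_image)
    have eq: "(+>) I ` J = (+>) I ` (Idl (I \<union> F))"
      using A(3) I.rcos_image_genideal_Un[OF F(1)] F(3) by simp
    have c: "I \<union> F \<subseteq> carrier R" using F(1) I.a_subset by blast
    have K: "ideal (Idl (I \<union> F)) R" "I \<subseteq> Idl (I \<union> F)"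
      using genideal_ideal[OF c] genideal_self[OF c] by auto
    have "J = Idl (I \<union> F)"
    proof
      show "J \<subseteq> Idl (I \<union> F)"
        by (rule q.image_eq_imp_subset[OF K(1) _ Jc]) (use K(2) eq in \<open>simp_all add: I.a_kernel_rcos\<close>)
      show "Idl (I \<union> F) \<subseteq> J"
        by (rule q.image_eq_imp_subset[OF J _ ideal_subset_carrier[OF K(1)]])
          (use IJ eq in \<open>simp_all add: I.a_kernel_rcos\<close>)
    qed
    then show "I \<noteq> J \<and> fg_ext R I J"
      using IJ F unfolding fg_ext_def by blast
  next
    assume R: "I \<noteq> J \<and> fg_ext R I J"
    then obtain F where F: "F \<subseteq> carrier R" "finite F" "J = Idl (I \<union> F)"
      unfolding fg_ext_def by blast
    have "I \<subset> J" using fg_ext_imp_subset[OF I] R by blast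
    moreover have "fg_ideal ((+>) I ` J) (R Quot I)"
      unfolding fg_ideal_def
    proof (intro conjI exI)
      show "ideal ((+>) I ` J) (R Quot I)" by (rule q.ideal_image[OF I.surj_rcos J])
      show "(+>) I ` F \<subseteq> carrier (R Quot I)" using F(1) I.surj_rcos by blast
      show "(+>) I ` J = Idl\<^bsub>R Quot I\<^esub> ((+>) I ` F)"
        unfolding F(3) by (rule I.rcos_image_genideal_Un[OF F(1)])
    qed (use F(2) in simp)
    ultimately show "fg_step R I J" unfolding fg_step_def ideal_quot_def by blast
  qed
qed

text \<open>Reflexive, because a homomorphism may map two neighbours to the same ideal.\<close>

abbreviation GF_adj :: "('a, 'b) ring_scheme \<Rightarrow> 'a set rel" where
  "GF_adj T \<equiv> (parcs (GF T))\<^sup>="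

lemma (in ring) GF_adj_iff:
  assumes "I \<in> proper_ideals R"
  shows "(I, J) \<in> GF_adj R \<longleftrightarrow> J \<in> proper_ideals R \<and> (fg_ext R I J \<or> fg_ext R J I)"
proof -
  have "fg_step R I J \<or> fg_step R J I \<longleftrightarrow> I \<noteq> J \<and> (fg_ext R I J \<or> fg_ext R J I)"
    if "J \<in> proper_ideals R"
    using fg_step_iff[OF assms[THEN proper_idealsD(1)] that[THEN proper_idealsD(1)]]
      fg_step_iff[OF that[THEN proper_idealsD(1)] assms[THEN proper_idealsD(1)]] by blast
  then show ?thesis
    using assms fg_ext_refl[OF proper_idealsD(1)[OF assms]] unfolding GF_def by auto
qed

lemma (in ring) GF_adj_imp_comparable:
  assumes "A \<in> proper_ideals R" "(A, B) \<in> GF_adj R"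
  shows "B \<in> proper_ideals R" "A \<subseteq> B \<or> B \<subseteq> A"
proof -
  show B: "B \<in> proper_ideals R" using assms GF_adj_iff by blast
  show "A \<subseteq> B \<or> B \<subseteq> A"
    using assms(2) GF_adj_iff[OF assms(1)] proper_idealsD(1)[OF assms(1)] proper_idealsD(1)[OF B]
      fg_ext_imp_subset by blast
qed

lemma (in ring) GF_adj_sym: "(A, B) \<in> GF_adj R \<Longrightarrow> (B, A) \<in> GF_adj R"
  unfolding GF_def by auto

lemma diam_geI:
  "I \<in> proper_ideals T \<Longrightarrow> J \<in> proper_ideals T \<Longrightarrow> graph_dist (GF T) I J \<le> diam (GF T)"
  unfolding diam_def by (intro SUP_upper2[of I] SUP_upper2[of J]) (simp_all add: GF_def)

lemma diam_leI:
  "(\<And>I J. I \<in> proper_ideals T \<Longrightarrow> J \<in> proper_ideals T \<Longrightarrow> graph_dist (GF T) I J \<le> c) \<Longrightarrow>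
    diam (GF T) \<le> c"
  unfolding diam_def by (intro SUP_least) (simp add: GF_def)

lemma GF_dist_le:
  assumes "I \<in> proper_ideals T" "(I, J) \<in> GF_adj T ^^ k"
  shows "graph_dist (GF T) I J \<le> ereal (real k)"
  by (rule graph_dist_le[OF pair_wf_digraph_GF _ assms(2)]) (simp add: GF_def assms(1))

lemma le_GF_dist:
  assumes "I \<in> proper_ideals T" "\<And>k. (I, J) \<in> GF_adj T ^^ k \<Longrightarrow> c \<le> ereal (real k)"
  shows "c \<le> graph_dist (GF T) I J"
  by (rule le_graph_dist[OF pair_wf_digraph_GF _ assms(2)]) (simp_all add: GF_def assms(1))

lemma two_le_GF_dist:
  assumes I: "I \<in> proper_ideals T" and na: "(I, J) \<notin> GF_adj T"
  shows "2 \<le> graph_dist (GF T) I J"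
proof (rule le_GF_dist[OF I])
  fix k assume walk: "(I, J) \<in> GF_adj T ^^ k"
  have "k \<noteq> 0"
  proof
    assume "k = 0"
    then have "I = J" using walk by (simp only: relpow.simps pair_in_Id_conv)
    then show False using na by blast
  qed
  moreover have "k \<noteq> 1" using walk na by (metis relpow_1)
  ultimately have "ereal 2 \<le> ereal (real k)" by simp
  then show "2 \<le> ereal (real k)" by simp
qed

section \<open>Walks along a surjective homomorphism\<close>

context ring_hom_ring
begin

definition pullback :: "'c set \<Rightarrow> 'a set" where
  "pullback I = {r \<in> carrier R. h r \<in> I}"

context
  assumes surj: "h ` carrier R = carrier S"
begin

lemma image_pullback: "I \<in> proper_ideals S \<Longrightarrow> h ` pullback I = I"
proof -
  assume "I \<in> proper_ideals S"
  then have "I \<subseteq> h ` carrier R" unfolding surj by (rule proper_idealsD(3))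
  then show ?thesis unfolding pullback_def by blast
qed

lemma pullback_proper:
  assumes I: "I \<in> proper_ideals S"
  shows "pullback I \<in> proper_ideals R"
proof (rule R.proper_idealsI)
  show "ideal (pullback I) R"
    unfolding pullback_def by (rule ideal_vimage[OF proper_idealsD(1)[OF I]])
  show "\<one>\<^bsub>R\<^esub> \<notin> pullback I"
    unfolding pullback_def using proper_idealsD(4)[OF I] by simp
qed

text \<open>If \<open>A\<close> lies below \<open>pullback I\<close>, its image lies in the proper ideal \<open>I\<close>. If \<open>A\<close> lies above, it
  contains the kernel, and then its image can only be everything if \<open>A\<close> is.\<close>

lemma image_proper:
  assumes I: "I \<in> proper_ideals S" and A: "A \<in> proper_ideals R"
    and cmp: "A \<subseteq> pullback I \<or> pullback I \<subseteq> A"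
  shows "h ` A \<in> proper_ideals S"
proof -
  have idl: "ideal (h ` A) S" by (rule ideal_image[OF surj proper_idealsD(1)[OF A]])
  have "h ` A \<noteq> carrier S"
    using cmp
  proof
    assume "A \<subseteq> pullback I"
    then have "h ` A \<subseteq> I" unfolding pullback_def by blast
    then show ?thesis using proper_idealsD(4)[OF I] by blast
  next
    assume "pullback I \<subseteq> A"
    moreover have "a_kernel R S h \<subseteq> pullback I"
      using additive_subgroup.zero_closed[OF ideal.axioms(1)[OF proper_idealsD(1)[OF I]]]
      unfolding a_kernel_def' pullback_def by auto
    ultimately have "a_kernel R S h \<subseteq> A" by blast
    then have "carrier R \<subseteq> A" if "h ` A = carrier S"
      using image_eq_imp_subset[OF proper_idealsD(1)[OF A], of "carrier R"] that surj by simp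
    then show ?thesis using proper_idealsD(4)[OF A] by blast
  qed
  with idl show ?thesis unfolding proper_ideals_def by blast
qed

lemma GF_adj_image:
  assumes "(A, B) \<in> GF_adj R" "A \<in> proper_ideals R" "h ` A \<in> proper_ideals S" "h ` B \<in> proper_ideals S"
  shows "(h ` A, h ` B) \<in> GF_adj S"
proof -
  have B: "B \<in> proper_ideals R" and "fg_ext R A B \<or> fg_ext R B A"
    using R.GF_adj_iff[OF assms(2)] assms(1) by blast+
  then have "fg_ext S (h ` A) (h ` B) \<or> fg_ext S (h ` B) (h ` A)"
    using fg_ext_image[OF surj] proper_idealsD(3)[OF assms(2)] proper_idealsD(3)[OF B] by blast
  then show ?thesis using S.GF_adj_iff[OF assms(3)] assms(4) by blast
qed

lemma GF_adj_pullback_image_proper: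
  assumes I: "I \<in> proper_ideals S" and adj: "(pullback I, A) \<in> GF_adj R"
  shows "A \<in> proper_ideals R" "h ` A \<in> proper_ideals S"
proof -
  note * = R.GF_adj_imp_comparable[OF pullback_proper[OF I] adj]
  show "A \<in> proper_ideals R" by (rule *(1))
  show "h ` A \<in> proper_ideals S" by (rule image_proper[OF I *(1)]) (use *(2) in blast)
qed

text \<open>The bound 3 makes every inner vertex of the walk a neighbour of one of the two endpoints, so
  that it has a proper image. The middle vertex of a walk of length 4 may be mapped onto \<open>S\<close>.\<close>

lemma short_walk_image:
  assumes I: "I \<in> proper_ideals S" and J: "J \<in> proper_ideals S"
    and walk: "(pullback I, pullback J) \<in> GF_adj R ^^ k" and k: "k \<le> 3"
  shows "(I, J) \<in> GF_adj S ^^ k"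
proof -
  let ?I = "pullback I" and ?J = "pullback J"
  note im = image_pullback[OF I] image_pullback[OF J]
  have nbr: "B \<in> proper_ideals R" "(K, h ` B) \<in> GF_adj S" "h ` B \<in> proper_ideals S"
    if "K \<in> proper_ideals S" "(pullback K, B) \<in> GF_adj R" for K B
    using GF_adj_pullback_image_proper[OF that]
      GF_adj_image[OF that(2) pullback_proper[OF that(1)]] image_pullback[OF that(1)] that(1) by auto
  consider "k = 0" | "k = 1" | "k = 2" | "k = 3" using k by linarith
  then show ?thesis
  proof cases
    case 1
    then have "?I = ?J" using walk by (simp only: relpow.simps pair_in_Id_conv)
    then have "I = J" using im by metis
    then show ?thesis using 1 by (simp only: relpow.simps pair_in_Id_conv)
  next
    case 2
    then have "(?I, ?J) \<in> GF_adj R" using walk by (simp only: relpow_1)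
    from nbr(2)[OF I this] 2 show ?thesis by (simp only: im relpow_1)
  next
    case 3
    then obtain B where B: "(?I, B) \<in> GF_adj R" "(B, ?J) \<in> GF_adj R"
      using relpow_2D walk by meson
    show ?thesis
      unfolding 3 by (rule relpow_2I[OF nbr(2)[OF I B(1)] S.GF_adj_sym[OF nbr(2)[OF J R.GF_adj_sym[OF B(2)]]]])
  next
    case 4
    then obtain B C where BC: "(?I, B) \<in> GF_adj R" "(B, C) \<in> GF_adj R" "(C, ?J) \<in> GF_adj R"
      using relpow_3D walk by meson
    note B = nbr[OF I BC(1)] and C = nbr[OF J R.GF_adj_sym[OF BC(3)]]
    have "(h ` B, h ` C) \<in> GF_adj S" by (rule GF_adj_image[OF BC(2) B(1) B(3) C(3)])
    then show ?thesis
      unfolding 4 by (rule relpow_3I[OF B(2) _ S.GF_adj_sym[OF C(2)]])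
  qed
qed

lemma GF_dist_pullback_ge:
  assumes I: "I \<in> proper_ideals S" and J: "J \<in> proper_ideals S"
  shows "min 4 (graph_dist (GF S) I J) \<le> graph_dist (GF R) (pullback I) (pullback J)"
proof (rule le_GF_dist[OF pullback_proper[OF I]])
  fix k assume walk: "(pullback I, pullback J) \<in> GF_adj R ^^ k"
  show "min 4 (graph_dist (GF S) I J) \<le> ereal (real k)"
  proof (cases "k \<le> 3")
    case True
    then show ?thesis
      using GF_dist_le[OF I short_walk_image[OF I J walk True]] by (auto simp: min_le_iff_disj)
  next
    case False
    then have "ereal 4 \<le> ereal (real k)" by simp
    then show ?thesis by (simp add: min_le_iff_disj)
  qed
qed

theorem min_diam_GF_le: "min 4 (diam (GF S)) \<le> diam (GF R)"
proof (cases "4 \<le> diam (GF R)")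
  case False
  have "diam (GF S) \<le> diam (GF R)"
  proof (rule diam_leI)
    fix I J assume IJ: "I \<in> proper_ideals S" "J \<in> proper_ideals S"
    have "min 4 (graph_dist (GF S) I J) \<le> diam (GF R)"
      using GF_dist_pullback_ge[OF IJ] diam_geI pullback_proper IJ by (meson order_trans)
    then show "graph_dist (GF S) I J \<le> diam (GF R)" using False by (auto simp: min_le_iff_disj)
  qed
  then show ?thesis by (simp add: min_le_iff_disj)
qed (simp add: min_le_iff_disj)

end

end

section \<open>Local and non-local rings\<close>

context ring
begin

lemma fg_extE:
  assumes "fg_ext R I J" "ideal I R"
  obtains F where "finite F" "F \<subseteq> J" "I \<subseteq> J" "ideal J R"
    "\<And>K. ideal K R \<Longrightarrow> I \<subseteq> K \<Longrightarrow> F \<subseteq> K \<Longrightarrow> J \<subseteq> K"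
proof -
  obtain F where F: "F \<subseteq> carrier R" "finite F" "J = Idl (I \<union> F)"
    using assms(1) unfolding fg_ext_def by blast
  have c: "I \<union> F \<subseteq> carrier R" using F(1) ideal_subset_carrier[OF assms(2)] by blast
  show thesis
  proof (rule that[OF F(2)])
    show "F \<subseteq> J" "I \<subseteq> J" using genideal_self[OF c] unfolding F(3) by blast+
    show "ideal J R" unfolding F(3) by (rule genideal_ideal[OF c])
    show "J \<subseteq> K" if "ideal K R" "I \<subseteq> K" "F \<subseteq> K" for K
      unfolding F(3) by (rule genideal_minimal[OF that(1)]) (use that in blast)
  qed
qed

lemma fg_ext_trans:
  assumes IJ: "fg_ext R I J" and JK: "fg_ext R J K" and I: "ideal I R"
  shows "fg_ext R I K"
proof -
  obtain F where F: "finite F" "F \<subseteq> J" "I \<subseteq> J" "ideal J R"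
    "\<And>L. ideal L R \<Longrightarrow> I \<subseteq> L \<Longrightarrow> F \<subseteq> L \<Longrightarrow> J \<subseteq> L"
    using fg_extE[OF IJ I] by blast
  obtain G where G: "finite G" "G \<subseteq> K" "J \<subseteq> K" "ideal K R"
    "\<And>L. ideal L R \<Longrightarrow> J \<subseteq> L \<Longrightarrow> G \<subseteq> L \<Longrightarrow> K \<subseteq> L"
    using fg_extE[OF JK F(4)] by blast
  show ?thesis
  proof (rule fg_extI[OF G(4)])
    show "I \<subseteq> K" "F \<union> G \<subseteq> K" "finite (F \<union> G)" using F(1-3) G(1-3) by auto
    show "K \<subseteq> L" if "ideal L R" "I \<subseteq> L" "F \<union> G \<subseteq> L" for L
      using F(5)[OF that(1,2)] G(5)[OF that(1)] that(3) by simp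
  qed
qed

lemma fg_ext_mono:
  assumes "fg_ext R I K" "ideal I R" "I \<subseteq> J" "J \<subseteq> K"
  shows "fg_ext R J K"
proof -
  obtain F where F: "finite F" "F \<subseteq> K" "I \<subseteq> K" "ideal K R"
    "\<And>L. ideal L R \<Longrightarrow> I \<subseteq> L \<Longrightarrow> F \<subseteq> L \<Longrightarrow> K \<subseteq> L"
    using fg_extE[OF assms(1,2)] by blast
  show ?thesis
    by (rule fg_extI[OF F(4) assms(4) F(2,1)]) (use F(5) assms(3) in \<open>meson order_trans\<close>)
qed

lemma fg_ext_adjoin:
  assumes "ideal I R" "f \<in> carrier R"
  shows "fg_ext R I (Idl (I \<union> {f}))"
  unfolding fg_ext_def using assms(2) by (intro exI[of _ "{f}"]) simp

lemma adjoin_mem: "ideal I R \<Longrightarrow> f \<in> I \<Longrightarrow> Idl (I \<union> {f}) = I"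
  using genideal_of_ideal by (simp add: insert_absorb)

lemma GF_adj_adjoin:
  assumes I: "I \<in> proper_ideals R" and f: "f \<in> carrier R" and "\<one> \<notin> Idl (I \<union> {f})"
  shows "(I, Idl (I \<union> {f})) \<in> GF_adj R" "Idl (I \<union> {f}) \<in> proper_ideals R" "f \<in> Idl (I \<union> {f})"
proof -
  have c: "I \<union> {f} \<subseteq> carrier R" using proper_idealsD(3)[OF I] f by simp
  show *: "Idl (I \<union> {f}) \<in> proper_ideals R"
    by (rule proper_idealsI[OF genideal_ideal[OF c] assms(3)])
  show "(I, Idl (I \<union> {f})) \<in> GF_adj R"
    using GF_adj_iff[OF I] * fg_ext_adjoin[OF proper_idealsD(1)[OF I] f] by blast
  show "f \<in> Idl (I \<union> {f})" using genideal_self[OF c] by simp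
qed

text \<open>Adjacency to 0 means being finitely generated.\<close>

lemma noetherian_if_diam_le_1:
  assumes nz: "\<one> \<noteq> \<zero>" and d: "diam (GF R) \<le> 1"
  shows "noetherian_ring R"
proof (rule noetherian_ringI)
  fix J assume J: "ideal J R"
  have z: "{\<zero>} \<in> proper_ideals R"
    by (rule proper_idealsI[OF zeroideal]) (use nz in simp)
  show "\<exists>A\<subseteq>carrier R. finite A \<and> J = Idl A"
  proof (cases "\<one> \<in> J")
    case True
    then have "J = Idl {\<one>}" using genideal_one ideal.one_imp_carrier[OF J] by simp
    then show ?thesis by (intro exI[of _ "{\<one>}"]) simp
  next
    case False
    then have Jp: "J \<in> proper_ideals R" by (rule proper_idealsI[OF J])
    have "({\<zero>}, J) \<in> GF_adj R"
    proof (rule ccontr)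
      assume na: "({\<zero>}, J) \<notin> GF_adj R"
      have "2 \<le> graph_dist (GF R) {\<zero>} J" by (rule two_le_GF_dist[OF z na])
      also have "\<dots> \<le> diam (GF R)" by (rule diam_geI[OF z Jp])
      also note d
      finally show False by simp
    qed
    then have "fg_ext R {\<zero>} J \<or> fg_ext R J {\<zero>}" using GF_adj_iff[OF z] by blast
    moreover have "fg_ext R {\<zero>} J" if "fg_ext R J {\<zero>}"
    proof -
      have "J \<subseteq> {\<zero>}" by (rule fg_ext_imp_subset[OF J that])
      moreover have "\<zero> \<in> J" by (rule additive_subgroup.zero_closed[OF ideal.axioms(1)[OF J]])
      ultimately have "J = {\<zero>}" by blast
      then show ?thesis using fg_ext_refl[OF zeroideal] by simp
    qed
    ultimately obtain F where "F \<subseteq> carrier R" "finite F" "J = Idl ({\<zero>} \<union> F)"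
      unfolding fg_ext_def by blast
    then show ?thesis by (intro exI[of _ "{\<zero>} \<union> F"]) simp
  qed
qed

lemma diam_le_2_if_noetherian:
  assumes nz: "\<one> \<noteq> \<zero>" and N: "noetherian_ring R"
  shows "diam (GF R) \<le> 2"
proof (rule diam_leI)
  fix I J assume I: "I \<in> proper_ideals R" and J: "J \<in> proper_ideals R"
  have z: "{\<zero>} \<in> proper_ideals R"
    by (rule proper_idealsI[OF zeroideal]) (use nz in simp)
  have adj: "({\<zero>}, K) \<in> GF_adj R" if K: "K \<in> proper_ideals R" for K
  proof -
    obtain A where A: "A \<subseteq> carrier R" "finite A" "K = Idl A"
      using noetherian_ring.finetely_gen[OF N proper_idealsD(1)[OF K]] by blast
    have "fg_ext R {\<zero>} K"
    proof (rule fg_extI[OF proper_idealsD(1)[OF K]])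
      show "{\<zero>} \<subseteq> K"
        using additive_subgroup.zero_closed[OF ideal.axioms(1)[OF proper_idealsD(1)[OF K]]] by simp
      show "A \<subseteq> K" unfolding A(3) by (rule genideal_self[OF A(1)])
      show "K \<subseteq> L" if "ideal L R" "A \<subseteq> L" for L
        unfolding A(3) by (rule genideal_minimal[OF that])
    qed (rule A(2))
    then show ?thesis using GF_adj_iff[OF z] K by blast
  qed
  have "(I, J) \<in> GF_adj R ^^ 2" by (rule relpow_2I[OF GF_adj_sym[OF adj[OF I]] adj[OF J]])
  from GF_dist_le[OF I this] show "graph_dist (GF R) I J \<le> 2" by simp
qed

end

context cring
begin

lemma PIdl_mult_subset:
  assumes "r \<in> carrier R" "a \<in> carrier R"
  shows "PIdl (r \<otimes> a) \<subseteq> PIdl a"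
proof -
  have "r \<otimes> a \<in> PIdl a" unfolding cgenideal_def using assms by blast
  then show ?thesis by (rule cgenideal_minimal[OF cgenideal_ideal[OF assms(2)]])
qed

lemma adjoin_one:
  assumes I: "ideal I R" and a: "a \<in> carrier R" and "\<one> \<in> Idl (I \<union> {a})"
  obtains i s where "i \<in> I" "s \<in> PIdl a" "i \<oplus> s = \<one>"
proof -
  have A: "ideal (PIdl a) R" by (rule cgenideal_ideal[OF a])
  have "Idl (I \<union> {a}) \<subseteq> Idl (I \<union> PIdl a)"
    by (rule subset_Idl_subset)
      (use ideal_subset_carrier[OF I] ideal_subset_carrier[OF A] cgenideal_self[OF a] in auto)
  then have "\<one> \<in> I <+> PIdl a" using assms(3) union_genideal[OF I A] by blast
  then obtain i s where "i \<in> I" "s \<in> PIdl a" "\<one> = i \<oplus> s"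
    unfolding set_add_def' by blast
  then show thesis using that[of i s] by simp
qed

text \<open>The walk passes through \<open>I \<inter> J\<close>: an element \<open>x\<close> of \<open>I\<close> is \<open>x i + x j\<close> with \<open>x j\<close> in \<open>I \<inter> J\<close>, so
  that \<open>I\<close> is generated by \<open>I \<inter> J\<close> and the single element \<open>i\<close>.\<close>

lemma comaximal_walk:
  assumes I: "I \<in> proper_ideals R" and J: "J \<in> proper_ideals R"
    and ij: "i \<in> I" "j \<in> J" "i \<oplus> j = \<one>"
  shows "(I, J) \<in> GF_adj R ^^ 2"
proof -
  have half: "(A \<inter> B, A) \<in> GF_adj R"
    if A: "A \<in> proper_ideals R" and B: "B \<in> proper_ideals R"
      and ab: "a \<in> A" "b \<in> B" "a \<oplus> b = \<one>" for A B a b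
  proof -
    note A' = proper_idealsD[OF A] and B' = proper_idealsD[OF B]
    have AB: "A \<inter> B \<in> proper_ideals R"
      by (rule proper_idealsI[OF i_intersect[OF A'(1) B'(1)]]) (use A'(4) in blast)
    have "fg_ext R (A \<inter> B) A"
    proof (rule fg_extI[OF A'(1), where F = "{a}"])
      fix K assume K: "ideal K R" "A \<inter> B \<subseteq> K" "{a} \<subseteq> K"
      show "A \<subseteq> K"
      proof
        fix x assume x: "x \<in> A"
        have c: "x \<in> carrier R" "a \<in> carrier R" "b \<in> carrier R" using x ab A'(3) B'(3) by auto
        have "x \<otimes> b \<in> A \<inter> B"
          using ideal.I_r_closed[OF A'(1) x c(3)] ideal.I_l_closed[OF B'(1) ab(2) c(1)] by simp
        moreover have "x \<otimes> a \<in> K" by (rule ideal.I_l_closed[OF K(1) _ c(1)]) (use K(3) in simp)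
        ultimately have "x \<otimes> a \<oplus> x \<otimes> b \<in> K"
          using K(2) additive_subgroup.a_closed[OF ideal.axioms(1)[OF K(1)]] by blast
        moreover have "x \<otimes> a \<oplus> x \<otimes> b = x" using c ab(3) r_distr[of a b x] by simp
        ultimately show "x \<in> K" by simp
      qed
    qed (use ab in auto)
    then show ?thesis using GF_adj_iff[OF AB] A by blast
  qed
  have "j \<oplus> i = \<one>" using ij a_comm[of j i] proper_idealsD(3)[OF I] proper_idealsD(3)[OF J] by auto
  from half[OF J I ij(2,1) this] have "(I \<inter> J, J) \<in> GF_adj R" by (simp only: Int_commute)
  with half[OF I J ij] show ?thesis by (intro relpow_2I[OF GF_adj_sym])
qed

text \<open>If \<open>f + g = 1\<close> such that \<open>I + (f)\<close> and \<open>J + (g)\<close> are proper, then these two ideals are comaximal,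
  and \<open>I\<close> and \<open>J\<close> are joined by a walk of length 4 through them.

  Otherwise one of the ideals generated by \<open>a\<close> and by \<open>b\<close> is comaximal to both \<open>I\<close> and \<open>J\<close>. To see
  this without maximal ideals, suppose that \<open>a\<close> is invertible modulo \<open>I\<close> but not modulo \<open>J\<close>. Writing
  \<open>1 = i + s\<close> with \<open>i\<close> in \<open>I\<close> and \<open>s\<close> a multiple of \<open>a\<close>, the pair \<open>f = i\<close>, \<open>g = s\<close> is of the excluded
  kind: \<open>I + (i)\<close> is \<open>I\<close>, and \<open>J + (s)\<close> lies in \<open>J + (a)\<close>. The same
  holds with \<open>I\<close> and \<open>J\<close> exchanged. So \<open>a\<close> is invertible modulo both ideals or
  modulo neither. In the latter case the pairs \<open>a, b\<close> and \<open>b, a\<close> show that \<open>b\<close> is invertible modulo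
  both.\<close>

lemma diam_le_4_if_comaximal:
  assumes ab: "a \<in> carrier R" "b \<in> carrier R" "a \<oplus> b = \<one>"
    and pa: "\<one> \<notin> PIdl a" and pb: "\<one> \<notin> PIdl b"
  shows "diam (GF R) \<le> 4"
proof (rule diam_leI)
  fix I J assume I: "I \<in> proper_ideals R" and J: "J \<in> proper_ideals R"
  note I' = proper_idealsD[OF I] and J' = proper_idealsD[OF J]
  define M where "M = (\<lambda>K f. Idl (K \<union> {f}))"
  have ba: "b \<oplus> a = \<one>" using ab a_comm by simp
  have M_s: "\<one> \<notin> M K s" if "ideal K R" "\<one> \<notin> M K c" "s \<in> PIdl c" "c \<in> carrier R" for K s c
  proof -
    have C: "K \<union> {c} \<subseteq> carrier R" using ideal_subset_carrier[OF that(1)] that(4) by simp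
    have Mc: "ideal (M K c) R" "K \<subseteq> M K c" "c \<in> M K c"
      using genideal_ideal[OF C] genideal_self[OF C] unfolding M_def by auto
    have "s \<in> M K c" using cgenideal_minimal[OF Mc(1,3)] that(3) by blast
    then have "Idl (K \<union> {s}) \<subseteq> M K c" using Mc by (intro genideal_minimal) auto
    then show ?thesis using that(2) unfolding M_def by blast
  qed
  have "(I, J) \<in> GF_adj R ^^ 4"
  proof (cases "\<exists>f \<in> carrier R. \<exists>g \<in> carrier R. f \<oplus> g = \<one> \<and> \<one> \<notin> M I f \<and> \<one> \<notin> M J g")
    case True
    then obtain f g where fg: "f \<in> carrier R" "g \<in> carrier R" "f \<oplus> g = \<one>"
      "\<one> \<notin> M I f" "\<one> \<notin> M J g" by blast
    note F = GF_adj_adjoin[OF I fg(1) fg(4)[unfolded M_def]]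
      and G = GF_adj_adjoin[OF J fg(2) fg(5)[unfolded M_def]]
    have "(Idl (I \<union> {f}), Idl (J \<union> {g})) \<in> GF_adj R ^^ 2"
      by (rule comaximal_walk[OF F(2) G(2) F(3) G(3) fg(3)])
    then have "(I, Idl (J \<union> {g})) \<in> GF_adj R ^^ Suc 2"
      using F(1) by (rule relpow_Suc_I2[rotated])
    then have "(I, J) \<in> GF_adj R ^^ Suc (Suc 2)"
      using GF_adj_sym[OF G(1)] by (rule relpow_Suc_I)
    moreover have "Suc (Suc 2) = (4 :: nat)" by simp
    ultimately show ?thesis by metis
  next
    case False
    \<comment> \<open>the walk through the principal ideal of \<open>c\<close>, in the role of \<open>a\<close> or of \<open>b\<close>\<close>
    have via: ?thesis
      if c: "c \<in> carrier R" "\<one> \<notin> PIdl c" and cI: "\<one> \<in> M I c" and cJ: "\<one> \<in> M J c" for c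
    proof -
      have C: "PIdl c \<in> proper_ideals R" by (rule proper_idealsI[OF cgenideal_ideal[OF c(1)] c(2)])
      obtain i s where iv: "i \<in> I" "s \<in> PIdl c" "i \<oplus> s = \<one>"
        by (rule adjoin_one[OF I'(1) c(1)]) (use cI in \<open>simp_all only: M_def\<close>)
      obtain j t where jt: "j \<in> J" "t \<in> PIdl c" "j \<oplus> t = \<one>"
        by (rule adjoin_one[OF J'(1) c(1)]) (use cJ in \<open>simp_all only: M_def\<close>)
      have "t \<oplus> j = \<one>" using jt a_comm[of t j] J'(3) proper_idealsD(3)[OF C] by auto
      then have "(I, J) \<in> GF_adj R ^^ (2 + 2)"
        using comaximal_walk[OF I C iv] comaximal_walk[OF C J jt(2,1)] unfolding relpow_add by blast
      then show ?thesis by simp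
    qed
    have no: "\<one> \<in> M I f \<or> \<one> \<in> M J g" if "f \<in> carrier R" "g \<in> carrier R" "f \<oplus> g = \<one>" for f g
      using False that by blast
    have I_both: False if ain: "\<one> \<in> M I a" and an: "\<one> \<notin> M J a"
    proof -
      obtain i s where iv: "i \<in> I" "s \<in> PIdl a" "i \<oplus> s = \<one>"
        by (rule adjoin_one[OF I'(1) ab(1)]) (use ain in \<open>simp_all only: M_def\<close>)
      have c: "i \<in> carrier R" "s \<in> carrier R"
        using iv I'(3) ideal_subset_carrier[OF cgenideal_ideal[OF ab(1)]] by auto
      have "\<one> \<notin> M I i" using adjoin_mem[OF I'(1) iv(1)] I'(4) unfolding M_def by simp
      moreover have "\<one> \<notin> M J s" by (rule M_s[OF J'(1) an iv(2) ab(1)])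
      ultimately show False using no[OF c iv(3)] by blast
    qed
    have J_both: False if ain: "\<one> \<in> M J a" and an: "\<one> \<notin> M I a"
    proof -
      obtain j s where js: "j \<in> J" "s \<in> PIdl a" "j \<oplus> s = \<one>"
        by (rule adjoin_one[OF J'(1) ab(1)]) (use ain in \<open>simp_all only: M_def\<close>)
      have c: "j \<in> carrier R" "s \<in> carrier R"
        using js J'(3) ideal_subset_carrier[OF cgenideal_ideal[OF ab(1)]] by auto
      have "\<one> \<notin> M J j" using adjoin_mem[OF J'(1) js(1)] J'(4) unfolding M_def by simp
      moreover have "\<one> \<notin> M I s" by (rule M_s[OF I'(1) an js(2) ab(1)])
      moreover have "s \<oplus> j = \<one>" using js(3) c a_comm by simp
      ultimately show False using no[OF c(2,1)] by blast
    qed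
    show ?thesis
    proof (cases "\<one> \<in> M I a")
      case True
      with I_both have "\<one> \<in> M J a" by blast
      with True show ?thesis by (rule via[OF ab(1) pa])
    next
      case False
      with J_both have "\<one> \<notin> M J a" by blast
      with False have "\<one> \<in> M I b" "\<one> \<in> M J b" using no[OF ab] no[OF ab(2,1) ba] by blast+
      then show ?thesis by (rule via[OF ab(2) pb])
    qed
  qed
  from GF_dist_le[OF I this] show "graph_dist (GF R) I J \<le> 4" by simp
qed

lemma diam_ge_2_if_comaximal:
  assumes ab: "a \<in> carrier R" "b \<in> carrier R" "a \<oplus> b = \<one>"
    and pa: "\<one> \<notin> PIdl a" and pb: "\<one> \<notin> PIdl b"
  shows "2 \<le> diam (GF R)"
proof -
  have A: "PIdl a \<in> proper_ideals R" by (rule proper_idealsI[OF cgenideal_ideal[OF ab(1)] pa])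
  have B: "PIdl b \<in> proper_ideals R" by (rule proper_idealsI[OF cgenideal_ideal[OF ab(2)] pb])
  have mem: "a \<in> PIdl a" "b \<in> PIdl b" using cgenideal_self ab by auto
  have inc: "\<not> (PIdl a \<subseteq> PIdl b \<or> PIdl b \<subseteq> PIdl a)"
  proof -
    have "\<one> \<in> K" if "ideal K R" "a \<in> K" "b \<in> K" for K
      using additive_subgroup.a_closed[OF ideal.axioms(1)[OF that(1)] that(2,3)] ab(3) by simp
    then show ?thesis
      using pa pb mem proper_idealsD(1)[OF A] proper_idealsD(1)[OF B] by blast
  qed
  then have "(PIdl a, PIdl b) \<notin> GF_adj R" using GF_adj_imp_comparable(2)[OF A] by blast
  then have "2 \<le> graph_dist (GF R) (PIdl a) (PIdl b)" by (rule two_le_GF_dist[OF A])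
  also have "\<dots> \<le> diam (GF R)" by (rule diam_geI[OF A B])
  finally show ?thesis .
qed

text \<open>The hypothesis \<open>loc\<close> says that two non-units never add up to 1; here \<open>a\<close> is a unit iff 1 lies in
  its principal ideal. If \<open>a + b\<close> is a unit, scaling by its inverse gives multiples of \<open>a\<close> and \<open>b\<close>
  that add up to 1.\<close>

lemma nonunits_ideal:
  assumes nz: "\<one> \<noteq> \<zero>"
    and loc: "\<And>a b. a \<in> carrier R \<Longrightarrow> b \<in> carrier R \<Longrightarrow> a \<oplus> b = \<one> \<Longrightarrow> \<one> \<in> PIdl a \<or> \<one> \<in> PIdl b"
  shows "{a \<in> carrier R. \<one> \<notin> PIdl a} \<in> proper_ideals R" (is "?M \<in> _")
proof (rule proper_idealsI)
  have l: "r \<otimes> a \<in> ?M" if "a \<in> ?M" "r \<in> carrier R" for a r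
    using that PIdl_mult_subset[of r a] by blast
  show "ideal ?M R"
  proof (rule idealI[OF ring_axioms])
    show "subgroup ?M (add_monoid R)"
    proof
      show "\<one>\<^bsub>add_monoid R\<^esub> \<in> ?M"
        using nz unfolding cgenideal_def by auto
      fix a assume a: "a \<in> ?M"
      have "inv\<^bsub>add_monoid R\<^esub> a = (\<ominus> \<one>) \<otimes> a"
        using a by (simp add: l_minus a_inv_def[symmetric])
      with l[OF a, of "\<ominus> \<one>"] show "inv\<^bsub>add_monoid R\<^esub> a \<in> ?M" by simp
      fix b assume b: "b \<in> ?M"
      have "\<one> \<notin> PIdl (a \<oplus> b)"
      proof
        assume "\<one> \<in> PIdl (a \<oplus> b)"
        then obtain r where r: "r \<in> carrier R" "\<one> = r \<otimes> (a \<oplus> b)" unfolding cgenideal_def by blast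
        then have "r \<otimes> a \<oplus> r \<otimes> b = \<one>" using a b r_distr[of a b r] by simp
        then have "\<one> \<in> PIdl (r \<otimes> a) \<or> \<one> \<in> PIdl (r \<otimes> b)"
          using r(1) a b by (intro loc) auto
        then show False using l[OF a r(1)] l[OF b r(1)] by blast
      qed
      then show "a \<otimes>\<^bsub>add_monoid R\<^esub> b \<in> ?M" using a b by simp
    qed auto
    show "x \<otimes> a \<in> ?M" if "a \<in> ?M" "x \<in> carrier R" for a x by (rule l[OF that])
    show "a \<otimes> x \<in> ?M" if "a \<in> ?M" "x \<in> carrier R" for a x
    proof -
      have "a \<otimes> x = x \<otimes> a" using that by (intro m_comm) auto
      with l[OF that] show ?thesis by simp
    qed
  qed
  show "\<one> \<notin> ?M" using cgenideal_self[of \<one>] by simp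
qed

text \<open>Let \<open>M\<close> be the maximal ideal. Whether \<open>M / A\<close> is finitely generated does not change along an
  edge. It is for \<open>A = M\<close>, so a walk from 0 to \<open>M\<close> shows that \<open>M\<close> is finitely generated. Then every
  proper ideal is adjacent to \<open>M\<close>.\<close>

lemma diam_le_2_if_local:
  assumes nz: "\<one> \<noteq> \<zero>"
    and loc: "\<And>a b. a \<in> carrier R \<Longrightarrow> b \<in> carrier R \<Longrightarrow> a \<oplus> b = \<one> \<Longrightarrow> \<one> \<in> PIdl a \<or> \<one> \<in> PIdl b"
    and fin: "diam (GF R) < \<infinity>"
  shows "diam (GF R) \<le> 2"
proof -
  define M where "M = {a \<in> carrier R. \<one> \<notin> PIdl a}"
  have M: "M \<in> proper_ideals R" unfolding M_def by (rule nonunits_ideal[OF nz loc])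
  have max: "K \<subseteq> M" if K: "K \<in> proper_ideals R" for K
  proof
    fix a assume a: "a \<in> K"
    have "PIdl a \<subseteq> K" by (rule cgenideal_minimal[OF proper_idealsD(1)[OF K] a])
    then show "a \<in> M" unfolding M_def using a proper_idealsD(3,4)[OF K] by blast
  qed
  have z: "{\<zero>} \<in> proper_ideals R"
    by (rule proper_idealsI[OF zeroideal]) (use nz in simp)
  have walk: "fg_ext R A M" if "(A, M) \<in> GF_adj R ^^ k" "A \<in> proper_ideals R" for A k
    using that
  proof (induction k arbitrary: A)
    case 0
    then have "A = M" by (simp only: relpow.simps pair_in_Id_conv)
    then show ?case using fg_ext_refl[OF proper_idealsD(1)[OF M]] by simp
  next
    case (Suc k)
    obtain B where B: "(A, B) \<in> GF_adj R" "(B, M) \<in> GF_adj R ^^ k"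
      using relpow_Suc_D2[OF Suc.prems(1)] by blast
    have Bp: "B \<in> proper_ideals R" by (rule GF_adj_imp_comparable(1)[OF Suc.prems(2) B(1)])
    note BM = Suc.IH[OF B(2) Bp]
    have "fg_ext R A B \<or> fg_ext R B A" using GF_adj_iff[OF Suc.prems(2)] B(1) by blast
    then show ?case
    proof
      assume "fg_ext R A B"
      then show ?thesis by (rule fg_ext_trans[OF _ BM proper_idealsD(1)[OF Suc.prems(2)]])
    next
      assume "fg_ext R B A"
      then have "B \<subseteq> A" by (rule fg_ext_imp_subset[OF proper_idealsD(1)[OF Bp]])
      then show ?thesis
        by (rule fg_ext_mono[OF BM proper_idealsD(1)[OF Bp] _ max[OF Suc.prems(2)]])
    qed
  qed
  have "\<exists>k. ({\<zero>}, M) \<in> GF_adj R ^^ k"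
  proof (rule ccontr)
    assume "\<not> ?thesis"
    then have "\<infinity> \<le> graph_dist (GF R) {\<zero>} M" by (intro le_GF_dist[OF z]) blast
    also have "\<dots> \<le> diam (GF R)" by (rule diam_geI[OF z M])
    finally show False using fin by simp
  qed
  then have zM: "fg_ext R {\<zero>} M" using walk z by blast
  have adj: "(K, M) \<in> GF_adj R" if K: "K \<in> proper_ideals R" for K
  proof -
    have "{\<zero>} \<subseteq> K"
      using additive_subgroup.zero_closed[OF ideal.axioms(1)[OF proper_idealsD(1)[OF K]]] by simp
    from fg_ext_mono[OF zM zeroideal this max[OF K]] show ?thesis using GF_adj_iff[OF K] M by blast
  qed
  show ?thesis
  proof (rule diam_leI)
    fix I J assume I: "I \<in> proper_ideals R" and J: "J \<in> proper_ideals R"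
    have "(I, J) \<in> GF_adj R ^^ 2" by (rule relpow_2I[OF adj[OF I] GF_adj_sym[OF adj[OF J]]])
    from GF_dist_le[OF I this] show "graph_dist (GF R) I J \<le> 2" by simp
  qed
qed

theorem diam_le_4_if_finite:
  assumes nz: "\<one> \<noteq> \<zero>" and fin: "diam (GF R) < \<infinity>"
  shows "diam (GF R) \<le> 4"
proof (cases "\<exists>a \<in> carrier R. \<exists>b \<in> carrier R. a \<oplus> b = \<one> \<and> \<one> \<notin> PIdl a \<and> \<one> \<notin> PIdl b")
  case True
  then show ?thesis using diam_le_4_if_comaximal by blast
next
  case False
  then have "diam (GF R) \<le> 2" by (intro diam_le_2_if_local[OF nz _ fin]) blast
  also have "(2 :: ereal) \<le> 4" by simp
  finally show ?thesis .
qed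

end

section \<open>Hilbert's basis theorem\<close>

text \<open>The basis theorem is proved for an arbitrary ring \<open>S\<close> that is generated by one element \<open>x\<close> over
  the image of \<open>R\<close>. As no freeness is required, one statement covers the adjunction of a variable as
  well as the passage from \<open>R\<close> to the constant polynomials (with \<open>x = 0\<close>).\<close>

context ring_hom_cring
begin

text \<open>The polynomial expressions in \<open>x\<close> of degree less than \<open>n\<close> with coefficients from \<open>R\<close>. The
  recursion splits off the top coefficient, which is what an induction on the degree removes.\<close>

primrec polys_below :: "'c \<Rightarrow> nat \<Rightarrow> 'c set" where
  "polys_below x 0 = {\<zero>\<^bsub>S\<^esub>}"
| "polys_below x (Suc n) =
     {h s \<otimes>\<^bsub>S\<^esub> x [^]\<^bsub>S\<^esub> n \<oplus>\<^bsub>S\<^esub> p | s p. s \<in> carrier R \<and> p \<in> polys_below x n}"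

text \<open>As \<open>x\<close> may be algebraic over \<open>R\<close>, an element of \<open>S\<close> has no leading coefficient of its own; an
  element of this set is the coefficient at \<open>x ^ n\<close> of some representation of an element of \<open>I\<close>.\<close>

definition lead_coeffs :: "'c \<Rightarrow> nat \<Rightarrow> 'c set \<Rightarrow> 'a set" where
  "lead_coeffs x n I =
     {s \<in> carrier R. \<exists>p \<in> polys_below x n. h s \<otimes>\<^bsub>S\<^esub> x [^]\<^bsub>S\<^esub> n \<oplus>\<^bsub>S\<^esub> p \<in> I}"

context
  fixes x assumes x: "x \<in> carrier S"
begin

lemma polys_below_carrier: "p \<in> polys_below x n \<Longrightarrow> p \<in> carrier S"
  using x by (induction n arbitrary: p) auto

lemma polys_below_mono: "polys_below x n \<subseteq> polys_below x (Suc n)"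
proof
  fix p assume p: "p \<in> polys_below x n"
  then have "p = h \<zero>\<^bsub>R\<^esub> \<otimes>\<^bsub>S\<^esub> x [^]\<^bsub>S\<^esub> n \<oplus>\<^bsub>S\<^esub> p"
    using x polys_below_carrier[OF p] by simp
  then show "p \<in> polys_below x (Suc n)" using p by (auto intro!: exI[of _ "\<zero>\<^bsub>R\<^esub>"] exI[of _ p])
qed

lemma polys_below_zero: "\<zero>\<^bsub>S\<^esub> \<in> polys_below x n"
  using polys_below_mono by (induction n) auto

lemma polys_below_add:
  "p \<in> polys_below x n \<Longrightarrow> q \<in> polys_below x n \<Longrightarrow> p \<oplus>\<^bsub>S\<^esub> q \<in> polys_below x n"
proof (induction n arbitrary: p q)
  case (Suc n)
  then obtain s p' t q' where
    p: "s \<in> carrier R" "p' \<in> polys_below x n" "p = h s \<otimes>\<^bsub>S\<^esub> x [^]\<^bsub>S\<^esub> n \<oplus>\<^bsub>S\<^esub> p'" and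
    q: "t \<in> carrier R" "q' \<in> polys_below x n" "q = h t \<otimes>\<^bsub>S\<^esub> x [^]\<^bsub>S\<^esub> n \<oplus>\<^bsub>S\<^esub> q'"
    by auto
  have "p \<oplus>\<^bsub>S\<^esub> q = h (s \<oplus>\<^bsub>R\<^esub> t) \<otimes>\<^bsub>S\<^esub> x [^]\<^bsub>S\<^esub> n \<oplus>\<^bsub>S\<^esub> (p' \<oplus>\<^bsub>S\<^esub> q')"
    using p q x polys_below_carrier[OF p(2)] polys_below_carrier[OF q(2)]
    by (simp add: S.l_distr S.a_ac)
  moreover have "p' \<oplus>\<^bsub>S\<^esub> q' \<in> polys_below x n" using Suc.IH p(2) q(2) by blast
  moreover have "s \<oplus>\<^bsub>R\<^esub> t \<in> carrier R" using p(1) q(1) by simp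
  ultimately show ?case by auto
qed simp

lemma polys_below_scale:
  "s \<in> carrier R \<Longrightarrow> p \<in> polys_below x n \<Longrightarrow> h s \<otimes>\<^bsub>S\<^esub> p \<in> polys_below x n"
proof (induction n arbitrary: p)
  case (Suc n)
  then obtain t q where
    q: "t \<in> carrier R" "q \<in> polys_below x n" "p = h t \<otimes>\<^bsub>S\<^esub> x [^]\<^bsub>S\<^esub> n \<oplus>\<^bsub>S\<^esub> q"
    by auto
  have "h s \<otimes>\<^bsub>S\<^esub> p = h (s \<otimes>\<^bsub>R\<^esub> t) \<otimes>\<^bsub>S\<^esub> x [^]\<^bsub>S\<^esub> n \<oplus>\<^bsub>S\<^esub> h s \<otimes>\<^bsub>S\<^esub> q"
    using q x polys_below_carrier[OF q(2)] Suc.prems(1) by (simp add: S.r_distr S.m_assoc)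
  moreover have "s \<otimes>\<^bsub>R\<^esub> t \<in> carrier R" using Suc.prems(1) q(1) by simp
  ultimately show ?case using Suc.IH[OF Suc.prems(1) q(2)] by auto
qed simp

lemma polys_below_diff:
  assumes p: "p \<in> polys_below x n" and q: "q \<in> polys_below x n"
  shows "p \<ominus>\<^bsub>S\<^esub> q \<in> polys_below x n"
proof -
  have "h (\<ominus>\<^bsub>R\<^esub> \<one>\<^bsub>R\<^esub>) \<otimes>\<^bsub>S\<^esub> q = \<ominus>\<^bsub>S\<^esub> q"
    using polys_below_carrier[OF q] by (simp add: S.l_minus)
  then show ?thesis
    using polys_below_add[OF p polys_below_scale[OF _ q, of "\<ominus>\<^bsub>R\<^esub> \<one>\<^bsub>R\<^esub>"]] by (simp add: S.minus_eq)
qed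

lemma polys_below_shift: "p \<in> polys_below x n \<Longrightarrow> x \<otimes>\<^bsub>S\<^esub> p \<in> polys_below x (Suc n)"
proof (induction n arbitrary: p)
  case 0
  then show ?case using x polys_below_zero[of "Suc 0"] by simp
next
  case (Suc n)
  then obtain t q where
    q: "t \<in> carrier R" "q \<in> polys_below x n" "p = h t \<otimes>\<^bsub>S\<^esub> x [^]\<^bsub>S\<^esub> n \<oplus>\<^bsub>S\<^esub> q"
    by auto
  have "x \<otimes>\<^bsub>S\<^esub> p = h t \<otimes>\<^bsub>S\<^esub> x [^]\<^bsub>S\<^esub> Suc n \<oplus>\<^bsub>S\<^esub> x \<otimes>\<^bsub>S\<^esub> q"
    using q(1) x polys_below_carrier[OF q(2)] unfolding q(3)
    by (simp add: S.r_distr S.m_ac)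
  moreover have "x \<otimes>\<^bsub>S\<^esub> q \<in> polys_below x (Suc n)" by (rule Suc.IH[OF q(2)])
  ultimately show ?case using q(1) unfolding polys_below.simps(2)[of x "Suc n"] by blast
qed

lemma lead_coeffsI:
  "s \<in> carrier R \<Longrightarrow> p \<in> polys_below x n \<Longrightarrow> h s \<otimes>\<^bsub>S\<^esub> x [^]\<^bsub>S\<^esub> n \<oplus>\<^bsub>S\<^esub> p \<in> I \<Longrightarrow>
    s \<in> lead_coeffs x n I"
  unfolding lead_coeffs_def by blast

lemma lead_coeffsE:
  assumes "s \<in> lead_coeffs x n I"
  obtains p where "s \<in> carrier R" "p \<in> polys_below x n"
    "h s \<otimes>\<^bsub>S\<^esub> x [^]\<^bsub>S\<^esub> n \<oplus>\<^bsub>S\<^esub> p \<in> I"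
  using assms unfolding lead_coeffs_def by blast

lemma lead_coeffs_ideal:
  assumes I: "ideal I S"
  shows "ideal (lead_coeffs x n I) R"
proof -
  have mult: "r \<otimes>\<^bsub>R\<^esub> s \<in> lead_coeffs x n I"
    if s: "s \<in> lead_coeffs x n I" and r: "r \<in> carrier R" for r s
    using s
  proof (rule lead_coeffsE)
    fix p assume p: "s \<in> carrier R" "p \<in> polys_below x n" "h s \<otimes>\<^bsub>S\<^esub> x [^]\<^bsub>S\<^esub> n \<oplus>\<^bsub>S\<^esub> p \<in> I"
    have "h (r \<otimes>\<^bsub>R\<^esub> s) \<otimes>\<^bsub>S\<^esub> x [^]\<^bsub>S\<^esub> n \<oplus>\<^bsub>S\<^esub> h r \<otimes>\<^bsub>S\<^esub> p =
        h r \<otimes>\<^bsub>S\<^esub> (h s \<otimes>\<^bsub>S\<^esub> x [^]\<^bsub>S\<^esub> n \<oplus>\<^bsub>S\<^esub> p)"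
      using p(1) r x polys_below_carrier[OF p(2)] by (simp add: S.r_distr S.m_assoc)
    also have "\<dots> \<in> I" using r by (intro ideal.I_l_closed[OF I p(3)]) simp
    finally show ?thesis
      using p(1) r by (intro lead_coeffsI[OF _ polys_below_scale[OF r p(2)]]) simp
  qed
  have sub: "lead_coeffs x n I \<subseteq> carrier R" unfolding lead_coeffs_def by blast
  show ?thesis
  proof (rule idealI[OF R.ring_axioms])
    show "subgroup (lead_coeffs x n I) (add_monoid R)"
    proof
      show "lead_coeffs x n I \<subseteq> carrier (add_monoid R)" using sub by simp
      have "h \<zero>\<^bsub>R\<^esub> \<otimes>\<^bsub>S\<^esub> x [^]\<^bsub>S\<^esub> n \<oplus>\<^bsub>S\<^esub> \<zero>\<^bsub>S\<^esub> = \<zero>\<^bsub>S\<^esub>" using x by simp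
      then have "\<zero>\<^bsub>R\<^esub> \<in> lead_coeffs x n I"
        using additive_subgroup.zero_closed[OF ideal.axioms(1)[OF I]]
        by (intro lead_coeffsI[OF R.zero_closed polys_below_zero]) simp
      then show "\<one>\<^bsub>add_monoid R\<^esub> \<in> lead_coeffs x n I" by simp
      fix a assume a: "a \<in> lead_coeffs x n I"
      then have ac: "a \<in> carrier R" using sub by blast
      have "inv\<^bsub>add_monoid R\<^esub> a = (\<ominus>\<^bsub>R\<^esub> \<one>\<^bsub>R\<^esub>) \<otimes>\<^bsub>R\<^esub> a"
        using ac by (simp add: R.l_minus a_inv_def[symmetric])
      with mult[OF a, of "\<ominus>\<^bsub>R\<^esub> \<one>\<^bsub>R\<^esub>"] show "inv\<^bsub>add_monoid R\<^esub> a \<in> lead_coeffs x n I" by simp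
      fix b assume b: "b \<in> lead_coeffs x n I"
      obtain p where p: "p \<in> polys_below x n" "h a \<otimes>\<^bsub>S\<^esub> x [^]\<^bsub>S\<^esub> n \<oplus>\<^bsub>S\<^esub> p \<in> I"
        by (rule lead_coeffsE[OF a])
      obtain q where q: "q \<in> polys_below x n" "h b \<otimes>\<^bsub>S\<^esub> x [^]\<^bsub>S\<^esub> n \<oplus>\<^bsub>S\<^esub> q \<in> I"
        by (rule lead_coeffsE[OF b])
      have bc: "b \<in> carrier R" using b sub by blast
      have "h (a \<oplus>\<^bsub>R\<^esub> b) \<otimes>\<^bsub>S\<^esub> x [^]\<^bsub>S\<^esub> n \<oplus>\<^bsub>S\<^esub> (p \<oplus>\<^bsub>S\<^esub> q) =
          (h a \<otimes>\<^bsub>S\<^esub> x [^]\<^bsub>S\<^esub> n \<oplus>\<^bsub>S\<^esub> p) \<oplus>\<^bsub>S\<^esub> (h b \<otimes>\<^bsub>S\<^esub> x [^]\<^bsub>S\<^esub> n \<oplus>\<^bsub>S\<^esub> q)"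
        using ac bc x polys_below_carrier[OF p(1)] polys_below_carrier[OF q(1)]
        by (simp add: S.l_distr S.a_ac)
      also have "\<dots> \<in> I"
        by (rule additive_subgroup.a_closed[OF ideal.axioms(1)[OF I] p(2) q(2)])
      finally have "a \<oplus>\<^bsub>R\<^esub> b \<in> lead_coeffs x n I"
        using ac bc by (intro lead_coeffsI[OF _ polys_below_add[OF p(1) q(1)]]) simp
      then show "a \<otimes>\<^bsub>add_monoid R\<^esub> b \<in> lead_coeffs x n I" by simp
    qed
    show "r \<otimes>\<^bsub>R\<^esub> s \<in> lead_coeffs x n I" if "s \<in> lead_coeffs x n I" "r \<in> carrier R" for s r
      by (rule mult[OF that])
    show "s \<otimes>\<^bsub>R\<^esub> r \<in> lead_coeffs x n I" if "s \<in> lead_coeffs x n I" "r \<in> carrier R" for s r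
    proof -
      have "s \<otimes>\<^bsub>R\<^esub> r = r \<otimes>\<^bsub>R\<^esub> s" using that sub by (intro R.m_comm) auto
      with mult[OF that] show ?thesis by simp
    qed
  qed
qed

lemma lead_coeffs_Suc:
  assumes I: "ideal I S"
  shows "lead_coeffs x n I \<subseteq> lead_coeffs x (Suc n) I"
proof
  fix s assume "s \<in> lead_coeffs x n I"
  then obtain p where p: "s \<in> carrier R" "p \<in> polys_below x n"
    "h s \<otimes>\<^bsub>S\<^esub> x [^]\<^bsub>S\<^esub> n \<oplus>\<^bsub>S\<^esub> p \<in> I" by (rule lead_coeffsE)
  have "h s \<otimes>\<^bsub>S\<^esub> x [^]\<^bsub>S\<^esub> Suc n \<oplus>\<^bsub>S\<^esub> x \<otimes>\<^bsub>S\<^esub> p = x \<otimes>\<^bsub>S\<^esub> (h s \<otimes>\<^bsub>S\<^esub> x [^]\<^bsub>S\<^esub> n \<oplus>\<^bsub>S\<^esub> p)"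
    using p(1) x polys_below_carrier[OF p(2)] by (simp add: S.r_distr S.m_ac)
  also have "\<dots> \<in> I" by (rule ideal.I_l_closed[OF I p(3) x])
  finally show "s \<in> lead_coeffs x (Suc n) I"
    by (rule lead_coeffsI[OF p(1) polys_below_shift[OF p(2)]])
qed

lemma lead_coeffs_mono: "ideal I S \<Longrightarrow> m \<le> n \<Longrightarrow> lead_coeffs x m I \<subseteq> lead_coeffs x n I"
  by (rule lift_Suc_mono_le[of "\<lambda>n. lead_coeffs x n I"]) (rule lead_coeffs_Suc)

text \<open>Subtracting from \<open>f\<close> an element of \<open>H\<close> with the same coefficient at \<open>x ^ n\<close> lowers the degree.\<close>

lemma lead_coeffs_determine:
  assumes I: "ideal I S" and H: "ideal H S" and HI: "H \<subseteq> I"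
    and lead: "\<And>n. lead_coeffs x n I \<subseteq> lead_coeffs x n H"
  shows "f \<in> I \<Longrightarrow> f \<in> polys_below x n \<Longrightarrow> f \<in> H"
proof (induction n arbitrary: f)
  case 0
  then show ?case using additive_subgroup.zero_closed[OF ideal.axioms(1)[OF H]] by simp
next
  case (Suc n)
  then obtain s p where f: "s \<in> carrier R" "p \<in> polys_below x n"
    "f = h s \<otimes>\<^bsub>S\<^esub> x [^]\<^bsub>S\<^esub> n \<oplus>\<^bsub>S\<^esub> p" by auto
  have "s \<in> lead_coeffs x n I"
    using Suc.prems(1) by (intro lead_coeffsI[OF f(1,2)]) (simp only: f(3))
  then have "s \<in> lead_coeffs x n H" using lead by blast
  then obtain q where q: "q \<in> polys_below x n" "h s \<otimes>\<^bsub>S\<^esub> x [^]\<^bsub>S\<^esub> n \<oplus>\<^bsub>S\<^esub> q \<in> H" (is "?g \<in> H")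
    by (rule lead_coeffsE)
  note pc = polys_below_carrier[OF f(2)] and qc = polys_below_carrier[OF q(1)]
  have tc: "h s \<otimes>\<^bsub>S\<^esub> x [^]\<^bsub>S\<^esub> n \<in> carrier S" using f(1) x by simp
  have eq: "f = (p \<ominus>\<^bsub>S\<^esub> q) \<oplus>\<^bsub>S\<^esub> ?g"
  proof -
    have "(p \<ominus>\<^bsub>S\<^esub> q) \<oplus>\<^bsub>S\<^esub> ?g = (p \<ominus>\<^bsub>S\<^esub> q) \<oplus>\<^bsub>S\<^esub> (q \<oplus>\<^bsub>S\<^esub> h s \<otimes>\<^bsub>S\<^esub> x [^]\<^bsub>S\<^esub> n)"
      using qc tc by (simp only: S.a_comm)
    also have "\<dots> = p \<oplus>\<^bsub>S\<^esub> h s \<otimes>\<^bsub>S\<^esub> x [^]\<^bsub>S\<^esub> n"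
      using pc qc tc by (simp add: S.minus_eq S.a_assoc S.r_neg1)
    also have "\<dots> = f" unfolding f(3) using pc tc by (simp only: S.a_comm)
    finally show ?thesis by simp
  qed
  have "p \<ominus>\<^bsub>S\<^esub> q = f \<ominus>\<^bsub>S\<^esub> ?g"
    using pc qc tc unfolding eq by (simp add: S.minus_eq S.a_assoc S.r_neg)
  also have "\<dots> \<in> I"
  proof -
    have "\<ominus>\<^bsub>S\<^esub> ?g \<in> I"
      using HI q(2) by (intro additive_subgroup.a_inv_closed[OF ideal.axioms(1)[OF I]]) blast
    then show ?thesis
      unfolding S.minus_eq
      by (rule additive_subgroup.a_closed[OF ideal.axioms(1)[OF I] Suc.prems(1)])
  qed
  finally have "p \<ominus>\<^bsub>S\<^esub> q \<in> H" by (rule Suc.IH[OF _ polys_below_diff[OF f(2) q(1)]])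
  then show ?case
    unfolding eq by (rule additive_subgroup.a_closed[OF ideal.axioms(1)[OF H] _ q(2)])
qed

text \<open>The ideals of leading coefficients of \<open>I\<close> increase with the degree, so they are constant from
  some \<open>N\<close> on. Elements of \<open>I\<close> that realise finitely many generators of each of the first ones
  generate an ideal \<open>H\<close> with the same leading coefficients as \<open>I\<close> in every degree.\<close>

theorem noetherian_if_polys_exhaust:
  assumes N: "noetherian_ring R" and gen: "carrier S \<subseteq> (\<Union>n. polys_below x n)"
  shows "noetherian_ring S"
proof (rule S.noetherian_ringI)
  fix I assume I: "ideal I S"
  let ?L = "\<lambda>n. lead_coeffs x n I"
  have "\<Union>(range ?L) \<in> range ?L"
  proof (rule noetherian_ring.ideal_chain_is_trivial[OF N])
    have "?L m \<subseteq> ?L n \<or> ?L n \<subseteq> ?L m" for m n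
      using lead_coeffs_mono[OF I] by (cases m n rule: le_cases) blast+
    then show "subset.chain {I. ideal I R} (range ?L)"
      unfolding subset_chain_def using lead_coeffs_ideal[OF I] by blast
  qed simp
  then obtain N where stable: "?L n \<subseteq> ?L N" for n by blast
  have "\<exists>A. A \<subseteq> carrier R \<and> finite A \<and> ?L n = Idl\<^bsub>R\<^esub> A" for n
    using noetherian_ring.finetely_gen[OF N lead_coeffs_ideal[OF I]] by blast
  then obtain A where A: "A n \<subseteq> carrier R" "finite (A n)" "?L n = Idl\<^bsub>R\<^esub> (A n)" for n
    by metis
  have pick: "\<exists>g. g \<in> I \<and> (\<exists>p \<in> polys_below x n. g = h a \<otimes>\<^bsub>S\<^esub> x [^]\<^bsub>S\<^esub> n \<oplus>\<^bsub>S\<^esub> p)" if "a \<in> A n" for a n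
  proof -
    have "a \<in> ?L n" unfolding A(3) using R.genideal_self[OF A(1)] that by blast
    then show ?thesis unfolding lead_coeffs_def by blast
  qed
  have ex: "\<forall>n. \<exists>g. \<forall>a \<in> A n. g a \<in> I \<and> (\<exists>p \<in> polys_below x n. g a = h a \<otimes>\<^bsub>S\<^esub> x [^]\<^bsub>S\<^esub> n \<oplus>\<^bsub>S\<^esub> p)"
    by (intro allI bchoice ballI) (rule pick)
  obtain g where "\<forall>n. \<forall>a \<in> A n. g n a \<in> I \<and>
      (\<exists>p \<in> polys_below x n. g n a = h a \<otimes>\<^bsub>S\<^esub> x [^]\<^bsub>S\<^esub> n \<oplus>\<^bsub>S\<^esub> p)"
    using choice[OF ex] by blast
  then have g: "g n a \<in> I"
    "\<exists>p \<in> polys_below x n. g n a = h a \<otimes>\<^bsub>S\<^esub> x [^]\<^bsub>S\<^esub> n \<oplus>\<^bsub>S\<^esub> p" if "a \<in> A n" for a n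
    using that by simp_all
  define G where "G = (\<Union>n\<le>N. g n ` A n)"
  have G: "finite G" "G \<subseteq> I" "G \<subseteq> carrier S"
    unfolding G_def using A(2) g(1) ideal_subset_carrier[OF I] by blast+
  define H where "H = Idl\<^bsub>S\<^esub> G"
  have H: "ideal H S" unfolding H_def by (rule S.genideal_ideal[OF G(3)])
  have HI: "H \<subseteq> I" unfolding H_def by (rule S.genideal_minimal[OF I G(2)])
  have GH: "G \<subseteq> H" unfolding H_def by (rule S.genideal_self[OF G(3)])
  have low: "?L n \<subseteq> lead_coeffs x n H" if n: "n \<le> N" for n
    unfolding A(3)
  proof (rule R.genideal_minimal[OF lead_coeffs_ideal[OF H]], rule subsetI)
    fix a assume a: "a \<in> A n"
    then have "g n a \<in> H" using GH n unfolding G_def by blast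
    then show "a \<in> lead_coeffs x n H"
      using g(2)[OF a] A(1)[of n] a unfolding lead_coeffs_def by force
  qed
  have "?L n \<subseteq> lead_coeffs x n H" for n
  proof (cases "n \<le> N")
    case False
    have "?L n \<subseteq> ?L N" by (rule stable)
    also have "\<dots> \<subseteq> lead_coeffs x N H" by (rule low) simp
    also have "\<dots> \<subseteq> lead_coeffs x n H" using False by (intro lead_coeffs_mono[OF H]) simp
    finally show ?thesis .
  qed (rule low)
  then have "I \<subseteq> H"
    using lead_coeffs_determine[OF I H HI] gen ideal_subset_carrier[OF I] by blast
  then show "\<exists>A\<subseteq>carrier S. finite A \<and> I = Idl\<^bsub>S\<^esub> A"
    using HI G(1,3) unfolding H_def by blast
qed

end

end

section \<open>Polynomial rings\<close>

context cring
begin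

lemma poly_ring_simps:
  "carrier (indexed_poly_ring I) = (carrier R)[\<X>\<^bsub>I\<^esub>]"
  "P \<otimes>\<^bsub>indexed_poly_ring I\<^esub> Q = indexed_mult P Q"
  "P \<oplus>\<^bsub>indexed_poly_ring I\<^esub> Q = P \<Oplus> Q"
  "\<one>\<^bsub>indexed_poly_ring I\<^esub> = indexed_const \<one>"
  "\<zero>\<^bsub>indexed_poly_ring I\<^esub> = indexed_const \<zero>"
  by (simp_all add: indexed_poly_ring_def)

lemma poly_coeff: "P \<in> carrier (indexed_poly_ring I) \<Longrightarrow> carrier_coeff P"
  unfolding poly_ring_simps indexed_pset_iff by blast

lemma const_in_poly_ring: "c \<in> carrier R \<Longrightarrow> indexed_const c \<in> carrier (indexed_poly_ring I)"
  unfolding poly_ring_simps by (rule indexed_pset.indexed_const)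

lemma indexed_var_in_poly_ring: "i \<in> I \<Longrightarrow> \<X>\<^bsub>i\<^esub> \<in> carrier (indexed_poly_ring I)"
  unfolding poly_ring_simps indexed_var_def
  by (intro indexed_pset.indexed_pmult indexed_pset.indexed_const) simp_all

lemma indexed_var_mult:
  assumes P: "P \<in> carrier (indexed_poly_ring I)"
  shows "\<X>\<^bsub>i\<^esub> \<otimes>\<^bsub>indexed_poly_ring I\<^esub> P = P \<Otimes> i"
proof -
  have 1: "carrier_coeff (indexed_const \<one>)"
    unfolding carrier_coeff_def indexed_const_def by simp
  have "indexed_mult (indexed_const \<one>) P = P"
    unfolding indexed_mult_const[OF one_closed poly_coeff[OF P]]
    using carrier_coeffE[OF poly_coeff[OF P]] by simp
  then show ?thesis
    unfolding poly_ring_simps indexed_var_def indexed_mult_pmult[OF 1 poly_coeff[OF P]] by simp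
qed

lemma const_ring_hom: "ring_hom_cring R (indexed_poly_ring I) indexed_const"
proof (rule RingHom.ring_hom_cringI[OF ring_hom_ringI])
  show "indexed_const (x \<otimes> y) = indexed_const x \<otimes>\<^bsub>indexed_poly_ring I\<^esub> indexed_const y"
    if "x \<in> carrier R" "y \<in> carrier R" for x y
    unfolding poly_ring_simps(2)
      indexed_mult_const[OF that(1) poly_coeff[OF const_in_poly_ring[OF that(2)]]]
    using that by (auto simp: indexed_const_def)
  show "indexed_const (x \<oplus> y) = indexed_const x \<oplus>\<^bsub>indexed_poly_ring I\<^esub> indexed_const y" for x y
    unfolding poly_ring_simps by (auto simp: indexed_padd_def indexed_const_def)
qed (simp_all add: const_in_poly_ring poly_ring_simps(4) cring.axioms(1)[OF cring_indexed_poly_ring]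
      cring_indexed_poly_ring ring_axioms is_cring)

lemma constant_coeff_ring_hom: "ring_hom_ring (indexed_poly_ring I) R (\<lambda>P. P {#})"
proof (rule ring_hom_ringI)
  fix P Q assume P: "P \<in> carrier (indexed_poly_ring I)" and Q: "Q \<in> carrier (indexed_poly_ring I)"
  note [simp] = carrier_coeffE[OF poly_coeff[OF P]] carrier_coeffE[OF poly_coeff[OF Q]]
  have "{k. k \<subseteq># ({#} :: 'c multiset)} = {{#}}" by auto
  then show "(P \<otimes>\<^bsub>indexed_poly_ring I\<^esub> Q) {#} = P {#} \<otimes> Q {#}"
    unfolding poly_ring_simps indexed_mult_def by simp
  show "(P \<oplus>\<^bsub>indexed_poly_ring I\<^esub> Q) {#} = P {#} \<oplus> Q {#}"
    unfolding poly_ring_simps indexed_padd_def by simp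
next
  show "\<one>\<^bsub>indexed_poly_ring I\<^esub> {#} = \<one>" unfolding poly_ring_simps indexed_const_def by simp
  show "P {#} \<in> carrier R" if "P \<in> carrier (indexed_poly_ring I)" for P
    by (rule carrier_coeffE[OF poly_coeff[OF that]])
qed (simp_all add: cring.axioms(1)[OF cring_indexed_poly_ring] ring_axioms)

lemma surj_constant_coeff: "(\<lambda>P. P {#}) ` carrier (indexed_poly_ring I) = carrier R"
proof
  show "carrier R \<subseteq> (\<lambda>P. P {#}) ` carrier (indexed_poly_ring I)"
  proof
    fix c assume "c \<in> carrier R"
    then show "c \<in> (\<lambda>P. P {#}) ` carrier (indexed_poly_ring I)"
      by (intro image_eqI[OF _ const_in_poly_ring]) (simp_all add: indexed_const_def)
  qed
qed (use carrier_coeffE[OF poly_coeff] in blast)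

lemma poly_ring_incl_hom:
  assumes "I \<subseteq> J"
  shows "ring_hom_cring (indexed_poly_ring I) (indexed_poly_ring J) (\<lambda>P. P)"
proof (rule RingHom.ring_hom_cringI[OF ring_hom_ringI])
  show "P \<in> carrier (indexed_poly_ring J)" if "P \<in> carrier (indexed_poly_ring I)" for P
    using that assms unfolding poly_ring_simps indexed_pset_iff by blast
qed (simp_all add: poly_ring_simps(2-4) cring.axioms(1)[OF cring_indexed_poly_ring] cring_indexed_poly_ring)

text \<open>A variable other than \<open>i\<close> acts as a scalar from the smaller ring, whereas \<open>i\<close> raises the degree.\<close>

lemma noetherian_poly_ring_insert:
  assumes N: "noetherian_ring (indexed_poly_ring I)"
  shows "noetherian_ring (indexed_poly_ring (insert i I))"
proof -
  let ?T = "indexed_poly_ring I" and ?U = "indexed_poly_ring (insert i I)"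
  interpret f: ring_hom_cring ?T ?U "\<lambda>P. P" by (rule poly_ring_incl_hom) blast
  have x: "\<X>\<^bsub>i\<^esub> \<in> carrier ?U" by (rule indexed_var_in_poly_ring) simp
  let ?B = "f.polys_below \<X>\<^bsub>i\<^esub>"
  have mono: "?B n \<subseteq> ?B k" if "n \<le> k" for n k
    using that by (rule lift_Suc_mono_le[of ?B, rotated]) (rule f.polys_below_mono[OF x])
  have "\<exists>n. P \<in> ?B n" if "P \<in> (carrier R)[\<X>\<^bsub>insert i I\<^esub>]" for P
    using that
  proof induction
    case (indexed_const k)
    have c: "indexed_const k \<in> carrier ?T" by (rule const_in_poly_ring[OF indexed_const])
    have "indexed_const k = indexed_const k \<otimes>\<^bsub>?U\<^esub> \<X>\<^bsub>i\<^esub> [^]\<^bsub>?U\<^esub> (0::nat) \<oplus>\<^bsub>?U\<^esub> \<zero>\<^bsub>?U\<^esub>"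
      using f.hom_closed[OF c] by simp
    then have "indexed_const k \<in> ?B (Suc 0)"
      unfolding f.polys_below.simps using c by blast
    then show ?case by blast
  next
    case (indexed_padd P Q)
    then obtain n k where "P \<in> ?B n" "Q \<in> ?B k" by blast
    then have "P \<in> ?B (max n k)" "Q \<in> ?B (max n k)"
      using mono[of n "max n k"] mono[of k "max n k"] by auto
    from f.polys_below_add[OF x this] show ?case unfolding poly_ring_simps(3) by blast
  next
    case (indexed_pmult P j)
    then obtain n where P: "P \<in> ?B n" by blast
    then have eq: "\<X>\<^bsub>j\<^esub> \<otimes>\<^bsub>?U\<^esub> P = P \<Otimes> j"
      by (intro indexed_var_mult f.polys_below_carrier[OF x])
    show ?case
    proof (cases "j = i")
      case True
      with f.polys_below_shift[OF x P] eq show ?thesis by metis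
    next
      case False
      then have "\<X>\<^bsub>j\<^esub> \<in> carrier ?T" using indexed_pmult.hyps by (intro indexed_var_in_poly_ring) simp
      from f.polys_below_scale[OF x this P] eq show ?thesis by metis
    qed
  qed
  then have "carrier ?U \<subseteq> (\<Union>n. ?B n)" unfolding poly_ring_simps(1) by blast
  then show ?thesis by (rule f.noetherian_if_polys_exhaust[OF x N])
qed

lemma noetherian_poly_ring_empty:
  assumes N: "noetherian_ring R"
  shows "noetherian_ring (indexed_poly_ring ({} :: 'c set))"
proof -
  let ?T = "indexed_poly_ring ({} :: 'c set)"
  interpret f: ring_hom_cring R ?T indexed_const by (rule const_ring_hom)
  have "P \<in> f.polys_below \<zero>\<^bsub>?T\<^esub> (Suc 0)" if P: "P \<in> carrier ?T" for P
  proof -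
    have "P {#} \<in> carrier R" by (rule carrier_coeffE[OF poly_coeff[OF P]])
    moreover have "P = indexed_const (P {#})"
    proof
      fix m show "P m = indexed_const (P {#}) m"
        using P unfolding poly_ring_simps indexed_pset_iff indexed_const_def by (cases "m = {#}") auto
    qed
    then have "P = indexed_const (P {#}) \<otimes>\<^bsub>?T\<^esub> \<zero>\<^bsub>?T\<^esub> [^]\<^bsub>?T\<^esub> (0::nat) \<oplus>\<^bsub>?T\<^esub> \<zero>\<^bsub>?T\<^esub>"
      using P by simp
    ultimately show ?thesis unfolding f.polys_below.simps by blast
  qed
  then have "carrier ?T \<subseteq> (\<Union>n. f.polys_below \<zero>\<^bsub>?T\<^esub> n)" by blast
  then show ?thesis by (rule f.noetherian_if_polys_exhaust[OF f.S.zero_closed N])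
qed

theorem noetherian_poly_ring:
  assumes N: "noetherian_ring R" and "finite I"
  shows "noetherian_ring (indexed_poly_ring I)"
  using assms(2)
proof (induction I rule: finite_induct)
  case empty
  show ?case by (rule noetherian_poly_ring_empty[OF N])
next
  case (insert i I)
  show ?case by (rule noetherian_poly_ring_insert[OF insert.IH])
qed

lemma one_not_in_PIdl_var:
  assumes nz: "\<one> \<noteq> \<zero>" and i: "i \<in> I"
  shows "\<one>\<^bsub>indexed_poly_ring I\<^esub> \<notin> PIdl\<^bsub>indexed_poly_ring I\<^esub> \<X>\<^bsub>i\<^esub>"
proof
  let ?T = "indexed_poly_ring I"
  interpret T: cring ?T by (rule cring_indexed_poly_ring)
  assume "\<one>\<^bsub>?T\<^esub> \<in> PIdl\<^bsub>?T\<^esub> \<X>\<^bsub>i\<^esub>"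
  then obtain P where P: "P \<in> carrier ?T" "\<one>\<^bsub>?T\<^esub> = P \<otimes>\<^bsub>?T\<^esub> \<X>\<^bsub>i\<^esub>"
    unfolding cgenideal_def by blast
  have "P \<otimes>\<^bsub>?T\<^esub> \<X>\<^bsub>i\<^esub> = P \<Otimes> i"
    using T.m_comm[OF P(1) indexed_var_in_poly_ring[OF i]] indexed_var_mult[OF P(1)] by metis
  then have "indexed_const \<one> = P \<Otimes> i" using P(2) unfolding poly_ring_simps by simp
  from fun_cong[OF this, of "{#}"] show False
    using nz by (simp add: indexed_const_def indexed_pmult_def)
qed

text \<open>An inverse \<open>P\<close> of \<open>1 - X\<close> would satisfy \<open>P = 1 + X P\<close>, so that all its coefficients at powers
  of \<open>X\<close> would be 1.\<close>

lemma one_not_in_PIdl_one_minus_var: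
  assumes nz: "\<one> \<noteq> \<zero>" and i: "i \<in> I"
  shows "\<one>\<^bsub>indexed_poly_ring I\<^esub> \<notin>
    PIdl\<^bsub>indexed_poly_ring I\<^esub> (\<one>\<^bsub>indexed_poly_ring I\<^esub> \<ominus>\<^bsub>indexed_poly_ring I\<^esub> \<X>\<^bsub>i\<^esub>)"
proof
  let ?T = "indexed_poly_ring I"
  interpret T: cring ?T by (rule cring_indexed_poly_ring)
  note X = indexed_var_in_poly_ring[OF i]
  assume "\<one>\<^bsub>?T\<^esub> \<in> PIdl\<^bsub>?T\<^esub> (\<one>\<^bsub>?T\<^esub> \<ominus>\<^bsub>?T\<^esub> \<X>\<^bsub>i\<^esub>)"
  then obtain P where P: "P \<in> carrier ?T" "\<one>\<^bsub>?T\<^esub> = P \<otimes>\<^bsub>?T\<^esub> (\<one>\<^bsub>?T\<^esub> \<ominus>\<^bsub>?T\<^esub> \<X>\<^bsub>i\<^esub>)"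
    unfolding cgenideal_def by blast
  have "P \<otimes>\<^bsub>?T\<^esub> (\<one>\<^bsub>?T\<^esub> \<ominus>\<^bsub>?T\<^esub> \<X>\<^bsub>i\<^esub>) \<oplus>\<^bsub>?T\<^esub> \<X>\<^bsub>i\<^esub> \<otimes>\<^bsub>?T\<^esub> P = P"
    using P(1) X by (simp add: T.minus_eq T.r_distr T.r_minus T.m_comm[OF X P(1)] T.a_assoc T.l_neg)
  then have "\<one>\<^bsub>?T\<^esub> \<oplus>\<^bsub>?T\<^esub> \<X>\<^bsub>i\<^esub> \<otimes>\<^bsub>?T\<^esub> P = P" by (simp only: P(2)[symmetric])
  from this[unfolded indexed_var_mult[OF P(1)], unfolded poly_ring_simps]
  have rec: "P = indexed_const \<one> \<Oplus> (P \<Otimes> i)" by (rule sym)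
  have "P (replicate_mset n i) = \<one>" for n
  proof (induction n)
    case 0
    have "P {#} = (indexed_const \<one> \<Oplus> (P \<Otimes> i)) {#}" by (rule fun_cong[OF rec])
    then show ?case by (simp add: indexed_padd_def indexed_const_def indexed_pmult_def)
  next
    case (Suc n)
    have "P (replicate_mset (Suc n) i) = (indexed_const \<one> \<Oplus> (P \<Otimes> i)) (replicate_mset (Suc n) i)"
      by (rule fun_cong[OF rec])
    then show ?case using Suc by (simp add: indexed_padd_def indexed_const_def indexed_pmult_def)
  qed
  then have "range (\<lambda>n. replicate_mset n i) \<subseteq> {m. P m \<noteq> \<zero>}" using nz by auto
  moreover have "finite {m. P m \<noteq> \<zero>}" using P(1) unfolding poly_ring_simps indexed_pset_iff by blast
  ultimately have "finite (range (\<lambda>n. replicate_mset n i))" by (rule finite_subset)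
  moreover have "inj (\<lambda>n. replicate_mset n i)" by (rule injI) (metis size_replicate_mset)
  ultimately show False using finite_imageD by blast
qed

lemma diam_poly_ring_bounds:
  assumes nz: "\<one> \<noteq> \<zero>" and i: "i \<in> I"
  shows "2 \<le> diam (GF (indexed_poly_ring I))" "diam (GF (indexed_poly_ring I)) \<le> 4"
proof -
  let ?T = "indexed_poly_ring I"
  interpret T: cring ?T by (rule cring_indexed_poly_ring)
  note X = indexed_var_in_poly_ring[OF i]
  have Y: "\<one>\<^bsub>?T\<^esub> \<ominus>\<^bsub>?T\<^esub> \<X>\<^bsub>i\<^esub> \<in> carrier ?T" using X by simp
  have "\<X>\<^bsub>i\<^esub> \<oplus>\<^bsub>?T\<^esub> (\<one>\<^bsub>?T\<^esub> \<ominus>\<^bsub>?T\<^esub> \<X>\<^bsub>i\<^esub>) = \<one>\<^bsub>?T\<^esub>"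
    by (simp only: T.minus_eq T.a_lcomm[OF X T.one_closed T.a_inv_closed[OF X]] T.r_neg[OF X]
        T.r_zero[OF T.one_closed])
  note * = X Y this one_not_in_PIdl_var[OF nz i] one_not_in_PIdl_one_minus_var[OF nz i]
  show "2 \<le> diam (GF ?T)" by (rule T.diam_ge_2_if_comaximal[OF *])
  show "diam (GF ?T) \<le> 4" by (rule T.diam_le_4_if_comaximal[OF *])
qed

lemma diam_poly_ring_noetherian:
  assumes nz: "\<one> \<noteq> \<zero>" and I: "finite I" "i \<in> I" and N: "noetherian_ring R"
  shows "diam (GF (indexed_poly_ring I)) = 2"
proof (rule antisym)
  interpret T: cring "indexed_poly_ring I" by (rule cring_indexed_poly_ring)
  have "indexed_const \<one> {#} \<noteq> indexed_const \<zero> {#}" using nz by (simp add: indexed_const_def)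
  then have "\<one>\<^bsub>indexed_poly_ring I\<^esub> \<noteq> \<zero>\<^bsub>indexed_poly_ring I\<^esub>" unfolding poly_ring_simps by metis
  then show "diam (GF (indexed_poly_ring I)) \<le> 2"
    by (rule T.diam_le_2_if_noetherian[OF _ noetherian_poly_ring[OF N I(1)]])
qed (rule diam_poly_ring_bounds(1)[OF nz I(2)])

end

section \<open>The diameter over a polynomial ring\<close>

theorem theorem6p15:
  fixes R :: "('a, 'b) ring_scheme" (structure) and m :: nat
  assumes "cring R" and "\<one> \<noteq> \<zero>" and "m \<ge> 1"
  shows "(diam (GF R) = \<infinity> \<longrightarrow> diam (GF (mpoly_ring R m)) = 4) \<and>
         (diam (GF R) < \<infinity> \<longrightarrow>
            diam (GF R) \<le> diam (GF (mpoly_ring R m)) \<and>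
            (diam (GF R) \<le> 1 \<longrightarrow> diam (GF (mpoly_ring R m)) = 2) \<and>
            (noetherian_ring R \<longrightarrow> diam (GF (mpoly_ring R m)) = 2) \<and>
            (diam (GF R) = 4 \<longrightarrow> diam (GF (mpoly_ring R m)) = 4))"
proof -
  interpret cring R by (rule assms(1))
  interpret ev: ring_hom_ring "mpoly_ring R m" R "\<lambda>P. P {#}" by (rule constant_coeff_ring_hom)
  have i: "1 \<in> {1..m}" using assms(3) by simp
  have low: "min 4 (diam (GF R)) \<le> diam (GF (mpoly_ring R m))"
    by (rule ev.min_diam_GF_le[OF surj_constant_coeff])
  have high: "diam (GF (mpoly_ring R m)) \<le> 4" by (rule diam_poly_ring_bounds(2)[OF assms(2) i])
  have noeth: "diam (GF (mpoly_ring R m)) = 2" if "noetherian_ring R"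
    by (rule diam_poly_ring_noetherian[OF assms(2) _ i that]) simp
  show ?thesis
  proof (intro conjI impI)
    assume "diam (GF R) = \<infinity>"
    then show "diam (GF (mpoly_ring R m)) = 4" using low high by (intro antisym) auto
  next
    assume "diam (GF R) < \<infinity>"
    then have "diam (GF R) \<le> 4" by (rule diam_le_4_if_finite[OF assms(2)])
    then show "diam (GF R) \<le> diam (GF (mpoly_ring R m))" using low by (simp add: min_absorb2)
  next
    assume "diam (GF R) \<le> 1"
    then show "diam (GF (mpoly_ring R m)) = 2" by (intro noeth noetherian_if_diam_le_1[OF assms(2)])
  next
    assume "noetherian_ring R"
    then show "diam (GF (mpoly_ring R m)) = 2" by (rule noeth)
  next
    assume "diam (GF R) = 4"
    then show "diam (GF (mpoly_ring R m)) = 4" using low high by (intro antisym) auto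
  qed
qed

end
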